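(* Let $n\in\mathbb{N}$, $\mathcal{N}=\{1,\dots,n\}$, let $g_i(s),k_i(s)$, $i\in\mathcal{N}$, be scalar transfer functions, $G(s)=\operatorname{diag}\{g_i(s)\}_{i=1}^n$, $K(s)=\operatorname{diag}\{k_i(s)\}_{i=1}^n$, and let $L_{\mathrm{ac}},L_{\mathrm{dc}}\in\mathbb{R}^{n\times n}$ be the weighted Laplacian matrices of the AC graph $(\mathcal{N},\mathcal{E}_{\mathrm{ac}})$ and the DC graph $(\mathcal{N},\mathcal{E}_{\mathrm{dc}})$. Let $\mathcal{N}_{\mathrm{dc}}^j$, $\overline{k_j^{-1}}(s)$, $\Delta(s)$, $\xi_i(s)$, $S_\delta$, $\lambda_{\mathrm{dc}}^{\max}$, $\lambda_{\mathrm{dc},j}^{\min}$, $n_{\mathrm{net}}^{\mathrm{dc}}$ be as defined in the context. Suppose there is $\delta\in\mathbb{R}_{>0}$ such that all of the following hold. (Bus dynamic conditions.) For every $i\in\mathcal{N}$: 1. $k_i^{-1}(s)$ is $\mathscr{H}_\infty$ stable; 2. there exists $c\in\mathbb{R}_{>0}$ such that $|g_i^{-1}(s)|\le c$ for all $s\in S_\delta$; 3. $\xi_i(s)>0$ for all $s\in\overline{\mathbb{C}}_+\setminus\{0\}$; and moreover 4. $\frac1n\sum_{i\in\mathcal{N}}\xi_i(s)>0$ for all $s\in\overline{\mathbb{C}}_+$. (Coherent dynamics of networked DC buses.) 5. $\Re\big(\overline{k_j^{-1}}(s)\big)>0$ for all $s\in\overline{\mathbb{C}}_+$ and all $j\in\{1,\dots,n_{\mathrm{net}}^{\mathrm{dc}}\}$,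 and there exists $c_1\in\mathbb{R}_{>0}$ such that $\Re\big(\overline{k_j^{-1}}(s)\big)\ge c_1$ for all $s\in S_\delta$ and all such $j$; 6. there exists $c_2\in\mathbb{R}_{>0}$ such that $\Delta(s)\le c_2|s|$ for all $s\in S_\delta$; 7. for all $s\in\overline{\mathbb{C}}_+\setminus\{0\}$, $$4\Big(\min_{i\in\mathcal{N}}\xi_i(s)\Big)\Big(\min_{j\in\{1,\dots,n_{\mathrm{net}}^{\mathrm{dc}}\}}\Re\big(\overline{k_j^{-1}}(s)\big)\frac{\lambda_{\mathrm{dc},j}^{\min}}{\lambda_{\mathrm{dc}}^{\max}}\Big)>\lambda_{\mathrm{dc}}^{\max}\,\Delta^2(s).$$ If $L_{\mathrm{ac}}$ and $L_{\mathrm{dc}}$ together represent the graph of a connected AC/DC network (i.e., the graph $(\mathcal{N},\mathcal{E}_{\mathrm{ac}}\cup\mathcal{E}_{\mathrm{dc}})$ is connected), then the transfer functions $$H(s)=\Big(G^{-1}(s)K^{-1}(s)+L_{\mathrm{dc}}K^{-1}(s)+\tfrac1s L_{\mathrm{ac}}\Big)^{-1}\quad\text{and}\quad K^{-1}(s)H(s)$$ are $\mathscr{H}_\infty$ stable.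
   Context: Notation: $\mathbb{C}_+$ is the open right half-plane $\{\Re(s)>0\}$ and $\overline{\mathbb{C}}_+=\{\Re(s)\ge 0\}$ its closure. $g_i^{-1}(s)=1/g_i(s)$ and $k_i^{-1}(s)=1/k_i(s)$; $G^{-1}(s),K^{-1}(s)$ are the corresponding diagonal matrices. $\mathscr{H}_\infty$ stability: a transfer function $F(s)\in\mathbb{C}^{m\times n}$ is $\mathscr{H}_\infty$ stable if $\|F\|_\infty:=\sup_{s\in\mathbb{C}_+}\sigma_{\max}(F(s))$ is bounded (finite), where $\sigma_{\max}$ is the largest singular value. Networks: $\mathcal{N}=\{1,\dots,n\}$ is the set of buses; $\mathcal{E}_{\mathrm{ac}}\subseteq\mathcal{N}\times\mathcal{N}$ and $\mathcal{E}_{\mathrm{dc}}\subseteq\mathcal{N}_{\mathrm{dc}}\times\mathcal{N}_{\mathrm{dc}}$ (with $\mathcal{N}_{\mathrm{dc}}\subseteq\mathcal{N}$ the set of converter buses) are the (undirected) sets of AC and DC lines, with positive symmetric edge weights (susceptances $b_{ij}$ for AC lines, conductances $g_{ij}$ for DC lines). $L_{\mathrm{ac}}$ has entries $-b_{ij}$ for $(i,j)\in\mathcal{E}_{\mathrm{ac}}$, $i\ne j$; diagonal entries $\sum_{(i,k)\in\mathcal{E}_{\mathrm{ac}}}b_{ik}$; and $0$ otherwise. $L_{\mathrm{dc}}$ is defined analogously over $(\mathcal{N},\mathcal{E}_{\mathrm{dc}})$ with weights $g_{ij}$, so rows and columns of buses not incident to a DC line vanish. DC subnetworks: a DC subnetwork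 is a connected component of the DC graph having at least two buses; $n_{\mathrm{net}}^{\mathrm{dc}}$ is the number of DC subnetworks, and $\mathcal{N}_{\mathrm{dc}}^j\subseteq\mathcal{N}$ and $\mathcal{E}_{\mathrm{dc}}^j$ are the node set and edge set of the $j$-th one. $L_{\mathrm{dc}}^j\in\mathbb{R}^{n\times n}$ is the Laplacian matrix of $(\mathcal{N},\mathcal{E}_{\mathrm{dc}}^j)$. $\lambda_{\mathrm{dc}}^{\max}$ is the largest eigenvalue of $L_{\mathrm{dc}}$ and $\lambda_{\mathrm{dc},j}^{\min}$ is the smallest non-zero eigenvalue of $L_{\mathrm{dc}}^j$. If there are no DC subnetworks, conditions 5–7 are vacuous. Definitions: $$\overline{k_j^{-1}}(s)=\frac{1}{|\mathcal{N}_{\mathrm{dc}}^j|}\sum_{i\in\mathcal{N}_{\mathrm{dc}}^j}k_i^{-1}(s),\qquad S_\delta=\{s\in\overline{\mathbb{C}}_+ : |s|<\delta\},$$ $$\Delta(s)=\max_{j\in\{1,\dots,n_{\mathrm{net}}^{\mathrm{dc}}\}}\ \max_{i\in\mathcal{N}_{\mathrm{dc}}^j}\big|k_i^{-1}(s)-\overline{k_j^{-1}}(s)\big|,\qquad \xi_i(s)=\Re\big(g_i^{-1}(s)k_i^{-1}(s)\big).$$ Background: $H(s)$ is the closed-loop transfer function from load disturbances to AC frequencies, and $K^{-1}(s)H(s)$ that from load disturbances to the vector of (filtered) machine frequencies and DC voltages.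
   Formalization: Scalar transfer functions are read as real-rational, evaluated pointwise, and each product g_i(s)k_i(s) is additionally assumed proper; without this the claim fails, e.g. n=1, no lines, g=1, k=s+1 gives H(s)=s+1, which is unbounded. *)

theory Defs
  imports "HOL-Analysis.Analysis" "HOL-Library.Landau_Symbols"
    "HOL-Computational_Algebra.Computational_Algebra"
begin

(* A scalar transfer function is a real-rational function of a complex variable, in lowest terms
   and evaluated pointwise.  Since x / 0 = 0, both f and 1 / f take the value 0 at their own
   poles.  For f \<noteq> 0 the value of 1 / f is therefore correct wherever 1 / f has no pole
   (also at the poles of f). *)
definition transfer_function :: "(complex \<Rightarrow> complex) \<Rightarrow> bool" where
  "transfer_function f \<longleftrightarrow>
     (\<exists>p q :: real poly. q \<noteq> 0 \<and> coprime p q \<and>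
        f = (\<lambda>s. poly (map_poly of_real p) s / poly (map_poly of_real q) s))"

(* For a rational function: the degree of the numerator is at most that of the denominator. *)
definition proper :: "(complex \<Rightarrow> complex) \<Rightarrow> bool" where
  "proper f \<longleftrightarrow> f \<in> O[at_infinity](\<lambda>_. 1)"

definition eigenvalue :: "'a::field ^ 'n ^ 'n \<Rightarrow> 'a \<Rightarrow> bool" where
  "eigenvalue A l \<longleftrightarrow> (\<exists>v. v \<noteq> 0 \<and> A *v v = l *s v)"

definition conj_transpose :: "complex ^ 'n ^ 'm \<Rightarrow> complex ^ 'm ^ 'n" where
  "conj_transpose A = (\<chi> i j. cnj (A $ j $ i))"

definition sigma_max :: "complex ^ 'n ^ 'm \<Rightarrow> real" where
  "sigma_max A = Max {sqrt l | l :: real. eigenvalue (conj_transpose A ** A) (complex_of_real l)}"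

definition hinf_stable :: "(complex \<Rightarrow> complex ^ 'n ^ 'm) \<Rightarrow> bool" where
  "hinf_stable F \<longleftrightarrow> bdd_above ((\<lambda>s. sigma_max (F s)) ` {s. Re s > 0})"

definition scalar_tf :: "(complex \<Rightarrow> complex) \<Rightarrow> complex \<Rightarrow> complex ^ 1 ^ 1" where
  "scalar_tf f s = (\<chi> i j. f s)"

definition diag :: "('n \<Rightarrow> complex) \<Rightarrow> complex ^ 'n ^ 'n" where
  "diag d = (\<chi> i j. if i = j then d i else 0)"

definition complex_matrix :: "real ^ 'n ^ 'm \<Rightarrow> complex ^ 'n ^ 'm" where
  "complex_matrix A = (\<chi> i j. complex_of_real (A $ i $ j))"

(* An undirected edge is stored in both orientations; only the values of w on E matter. *)
definition weighted_graph :: "('n \<times> 'n) set \<Rightarrow> ('n \<Rightarrow> 'n \<Rightarrow> real) \<Rightarrow> bool" where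
  "weighted_graph E w \<longleftrightarrow>
     sym E \<and> irrefl E \<and> (\<forall>(i, j) \<in> E. w i j > 0 \<and> w i j = w j i)"

definition laplacian :: "('n::finite \<times> 'n) set \<Rightarrow> ('n \<Rightarrow> 'n \<Rightarrow> real) \<Rightarrow> real ^ 'n ^ 'n" where
  "laplacian E w = (\<chi> i j. if i = j then (\<Sum>k | (i, k) \<in> E. w i k)
                          else if (i, j) \<in> E then - w i j else 0)"

definition graph_connected :: "('n \<times> 'n) set \<Rightarrow> bool" where
  "graph_connected E \<longleftrightarrow> E\<^sup>* = UNIV"

(* Subnetworks are indexed by their node sets instead of by 1, ..., n_net. *)
definition subnetworks :: "('n \<times> 'n) set \<Rightarrow> 'n set set" where
  "subnetworks E = {C \<in> UNIV // E\<^sup>*. card C \<ge> 2}"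

definition subnet_edges :: "('n \<times> 'n) set \<Rightarrow> 'n set \<Rightarrow> ('n \<times> 'n) set" where
  "subnet_edges E C = E \<inter> C \<times> C"

definition lambda_max :: "('n::finite \<times> 'n) set \<Rightarrow> ('n \<Rightarrow> 'n \<Rightarrow> real) \<Rightarrow> real" where
  "lambda_max E w = Max {l. eigenvalue (laplacian E w) l}"

definition lambda_min :: "('n::finite \<times> 'n) set \<Rightarrow> ('n \<Rightarrow> 'n \<Rightarrow> real) \<Rightarrow> 'n set \<Rightarrow> real" where
  "lambda_min E w C = Min {l. eigenvalue (laplacian (subnet_edges E C) w) l \<and> l \<noteq> 0}"

definition S_delta :: "real \<Rightarrow> complex set" where
  "S_delta \<delta> = {s. Re s \<ge> 0 \<and> norm s < \<delta>}"

definition kinv_mean :: "('n \<Rightarrow> complex \<Rightarrow> complex) \<Rightarrow> 'n set \<Rightarrow> complex \<Rightarrow> complex" where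
  "kinv_mean k C s = (\<Sum>i\<in>C. 1 / k i s) / of_nat (card C)"

(* Only meaningful if there is at least one subnetwork. *)
definition Delta :: "('n \<times> 'n) set \<Rightarrow> ('n \<Rightarrow> complex \<Rightarrow> complex) \<Rightarrow> complex \<Rightarrow> real" where
  "Delta E k s = (MAX C \<in> subnetworks E. MAX i \<in> C. norm (1 / k i s - kinv_mean k C s))"

definition xi :: "('n \<Rightarrow> complex \<Rightarrow> complex) \<Rightarrow> ('n \<Rightarrow> complex \<Rightarrow> complex) \<Rightarrow> 'n \<Rightarrow> complex \<Rightarrow> real" where
  "xi g k i s = Re (1 / g i s * (1 / k i s))"

definition diag_inv :: "('n \<Rightarrow> complex \<Rightarrow> complex) \<Rightarrow> complex \<Rightarrow> complex ^ 'n ^ 'n" where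
  "diag_inv g s = diag (\<lambda>i. 1 / g i s)"

definition Hinv :: "('n::finite \<Rightarrow> complex \<Rightarrow> complex) \<Rightarrow> ('n \<Rightarrow> complex \<Rightarrow> complex) \<Rightarrow>
    real ^ 'n ^ 'n \<Rightarrow> real ^ 'n ^ 'n \<Rightarrow> complex \<Rightarrow> complex ^ 'n ^ 'n" where
  "Hinv g k Lac Ldc s =
     diag_inv g s ** diag_inv k s + complex_matrix Ldc ** diag_inv k s + mat (1 / s) ** complex_matrix Lac"

definition H :: "('n::finite \<Rightarrow> complex \<Rightarrow> complex) \<Rightarrow> ('n \<Rightarrow> complex \<Rightarrow> complex) \<Rightarrow>
    real ^ 'n ^ 'n \<Rightarrow> real ^ 'n ^ 'n \<Rightarrow> complex \<Rightarrow> complex ^ 'n ^ 'n" where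
  "H g k Lac Ldc s = matrix_inv (Hinv g k Lac Ldc s)"

end

theory Submission
  imports Defs
begin

text \<open>
  Both stability claims follow from a bound \<open>c * norm v \<le> norm (H(s)\<^sup>-\<^sup>1 v)\<close> with \<open>c > 0\<close>, uniform over
  the open right half-plane. If it fails, there are points \<open>s\<^sub>n\<close> and unit vectors \<open>v\<^sub>n\<close> with
  \<open>H(s\<^sub>n)\<^sup>-\<^sup>1 v\<^sub>n\<close> tending to 0, and one may assume that \<open>v\<^sub>n\<close> tends to a unit vector \<open>v\<close> and that
  \<open>s\<^sub>n\<close> converges or tends to infinity.

  If the limit of \<open>s\<^sub>n\<close> is nonzero, \<open>v\<close> is in the kernel of the limit operator; but split
  \<open>1 / k\<^sub>i\<close> into the mean over the DC component and a deviation, and use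
  \<open>norm (L\<^sub>d\<^sub>c v)\<^sup>2 \<le> \<lambda>\<^sub>m\<^sub>a\<^sub>x * inner v (L\<^sub>d\<^sub>c v)\<close>: condition 7 makes the real part of the numerical range positive.
  If \<open>s\<^sub>n\<close> tends to 0, multiplying by \<open>s\<^sub>n\<close> gives \<open>L\<^sub>a\<^sub>c v = 0\<close>, the real part of the quadratic form gives
  \<open>L\<^sub>d\<^sub>c v = 0\<close>, hence \<open>v\<close> is constant by connectivity, which contradicts condition 4.
  If \<open>s\<^sub>n\<close> tends to infinity, condition 7 need not survive in the limit. Instead, \<open>1 / k\<^sub>i\<close> tends to a
  real \<open>\<kappa>\<^sub>i\<close>, which is nonnegative on the DC network because \<open>1 / k\<^sub>i\<close> is real, positive at 0 and without zeros on
  the positive axis, and \<open>1 / (g\<^sub>i k\<^sub>i)\<close> tends to infinity or to a positive real. Testing the limit equation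
  with the vector \<open>\<kappa>\<^sub>i v\<^sub>i\<close> yields \<open>v = 0\<close>.
\<close>

subsection \<open>Self-adjoint operators and singular values\<close>

text \<open>The quadratic \<open>a + 2 * t * b + t\<^sup>2 * c\<close> in \<open>t\<close> is a
  nonnegative value of the form, so its discriminant is not positive. The form may be degenerate,
  hence the separate case \<open>c = 0\<close>.\<close>

lemma psd_cauchy_schwarz:
  fixes T :: "'a::real_inner \<Rightarrow> 'a"
  assumes lin: "linear T" and sa: "\<And>x y. inner x (T y) = inner (T x) y" and psd: "\<And>x. inner x (T x) \<ge> 0"
  shows "(inner x (T y))\<^sup>2 \<le> inner x (T x) * inner y (T y)"
proof -
  define a b c where "a = inner x (T x)" and "b = inner x (T y)" and "c = inner y (T y)"
  have ex: "a + 2 * t * b + t\<^sup>2 * c \<ge> 0" for t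
  proof -
    have "inner y (T x) = b"
      by (metis b_def inner_commute sa)
    then have "inner (x + t *\<^sub>R y) (T (x + t *\<^sub>R y)) = a + 2 * t * b + t\<^sup>2 * c"
      by (simp add: linear_add[OF lin] linear_scale[OF lin] inner_simps a_def b_def c_def algebra_simps power2_eq_square)
    then show ?thesis using psd by metis
  qed
  have "c \<ge> 0" unfolding c_def by (rule psd)
  show ?thesis
  proof (cases "c = 0")
    case True
    have "b = 0"
    proof (rule ccontr)
      assume "b \<noteq> 0"
      \<comment> \<open>With \<open>c = 0\<close> the expression is affine in \<open>t\<close>, and
        this \<open>t\<close> gives it the value -1.\<close>
      then show False using ex[of "- (a + 1) / (2 * b)"] True by (simp add: field_simps)
    qed
    then show ?thesis using True by (simp add: a_def b_def c_def)
  next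
    case False
    with \<open>c \<ge> 0\<close> have "c > 0" by simp
    have "a + 2 * (- b / c) * b + (- b / c)\<^sup>2 * c = a - b\<^sup>2 / c"
      using \<open>c > 0\<close> by (simp add: field_simps power2_eq_square)
    then have "b\<^sup>2 / c \<le> a" using ex[of "- b / c"] by simp
    then show ?thesis using \<open>c > 0\<close> by (simp add: a_def b_def c_def field_simps)
  qed
qed

text \<open>The Rayleigh quotient attains its maximum \<open>l\<close> on the unit sphere, say at
  \<open>v\<close>. Then \<open>l - T\<close> is positive semidefinite with form zero at
  \<open>v\<close>, and Cauchy-Schwarz for that form forces \<open>v\<close> into its
  kernel.\<close>

lemma selfadjoint_top_eigenvalue:
  fixes T :: "'a::euclidean_space \<Rightarrow> 'a"
  assumes lin: "linear T" and sa: "\<And>x y. inner x (T y) = inner (T x) y"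
  obtains l v where "v \<noteq> 0" "T v = l *\<^sub>R v" "\<And>x. inner x (T x) \<le> l * (norm x)\<^sup>2"
proof -
  have cont: "continuous_on (sphere 0 1) (\<lambda>x. inner x (T x))"
    by (intro continuous_intros linear_continuous_on linear_conv_bounded_linear[THEN iffD1] lin)
  obtain e :: 'a where "e \<in> Basis" using nonempty_Basis by blast
  then have "sphere (0::'a) 1 \<noteq> {}" by (auto intro!: exI[of _ e])
  with cont obtain v where v: "norm v = 1" and max: "\<And>y. norm y = 1 \<Longrightarrow> inner y (T y) \<le> inner v (T v)"
    using continuous_attains_sup[OF compact_sphere, of 0 1 "\<lambda>x. inner x (T x)"] by auto
  define l where "l = inner v (T v)"
  have bound: "inner x (T x) \<le> l * (norm x)\<^sup>2" for x
  proof (cases "x = 0")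
    case True then show ?thesis by simp
  next
    case False
    have "inner (x /\<^sub>R norm x) (T (x /\<^sub>R norm x)) \<le> l"
      unfolding l_def using False by (intro max) simp
    then show ?thesis
      using False by (simp add: linear_scale[OF lin] field_simps power2_eq_square)
  qed
  define S where "S x = l *\<^sub>R x - T x" for x
  have linS: "linear S" unfolding S_def by (intro linear_compose_sub linear_scale_self lin)
  have saS: "inner x (S y) = inner (S x) y" for x y by (simp add: S_def inner_simps sa)
  have psdS: "inner x (S x) \<ge> 0" for x
    using bound[of x] by (simp add: S_def inner_simps power2_norm_eq_inner)
  have "inner v (S v) = 0" using v by (simp add: S_def inner_simps l_def flip: power2_norm_eq_inner)
  then have "inner (S v) (S v) = 0"
    using psd_cauchy_schwarz[OF linS saS psdS, of "S v" v] by simp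
  then have "T v = l *\<^sub>R v" by (simp add: S_def)
  moreover have "v \<noteq> 0" using v by auto
  ultimately show ?thesis using that bound by blast
qed

text \<open>Eigenvectors for distinct eigenvalues are orthogonal, hence independent. Finiteness
  gives meaning to the \<open>Max\<close> and \<open>Min\<close> over eigenvalues in the
  definitions.\<close>

lemma finite_selfadjoint_eigenvalues:
  fixes T :: "'a::euclidean_space \<Rightarrow> 'a"
  assumes sa: "\<And>x y. inner x (T y) = inner (T x) y"
  shows "finite {l. \<exists>v. v \<noteq> 0 \<and> T v = l *\<^sub>R v}"
proof -
  let ?L = "{l. \<exists>v. v \<noteq> 0 \<and> T v = l *\<^sub>R v}"
  obtain f where f: "\<And>l. l \<in> ?L \<Longrightarrow> f l \<noteq> 0 \<and> T (f l) = l *\<^sub>R f l"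
    using bchoice[of ?L "\<lambda>l v. v \<noteq> 0 \<and> T v = l *\<^sub>R v"] by blast
  have orth: "orthogonal (f l) (f m)" if "l \<in> ?L" "m \<in> ?L" "l \<noteq> m" for l m
  proof -
    have "inner (f l) (T (f m)) = inner (T (f l)) (f m)" by (rule sa)
    then have "m * inner (f l) (f m) = l * inner (f l) (f m)"
      using f[OF that(1)] f[OF that(2)] by simp
    then show ?thesis using that(3) by (simp add: orthogonal_def)
  qed
  have "inj_on f ?L"
  proof (rule inj_onI, rule ccontr)
    fix l m assume *: "l \<in> ?L" "m \<in> ?L" "f l = f m" "l \<noteq> m"
    have "orthogonal (f l) (f l)" using orth[OF *(1,2,4)] *(3) by simp
    then show False using f[OF *(1)] by (simp add: orthogonal_self)
  qed
  moreover have "finite (f ` ?L)"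
  proof (rule independent_imp_finite, rule pairwise_orthogonal_independent)
    show "pairwise orthogonal (f ` ?L)"
      by (auto simp: pairwise_def intro!: orth)
    show "0 \<notin> f ` ?L" using f by fastforce
  qed
  ultimately show ?thesis by (rule finite_imageD[rotated])
qed

section \<open>The largest singular value as the operator norm\<close>

lemma inner_conj_transpose:
  fixes A :: "complex ^ 'n ^ 'm"
  shows "inner x (conj_transpose A *v y) = inner (A *v x) y"
proof -
  have "inner x (conj_transpose A *v y) = (\<Sum>i\<in>UNIV. \<Sum>j\<in>UNIV. inner (x $ i) (cnj (A $ j $ i) * y $ j))"
    by (simp add: inner_vec_def matrix_vector_mult_def conj_transpose_def inner_sum_right)
  also have "\<dots> = (\<Sum>i\<in>UNIV. \<Sum>j\<in>UNIV. inner (A $ j $ i * x $ i) (y $ j))"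
    by (intro sum.cong refl) (simp add: inner_complex_def algebra_simps)
  also have "\<dots> = (\<Sum>j\<in>UNIV. \<Sum>i\<in>UNIV. inner (A $ j $ i * x $ i) (y $ j))"
    by (rule sum.swap)
  also have "\<dots> = inner (A *v x) y"
    by (simp add: inner_vec_def matrix_vector_mult_def inner_sum_left)
  finally show ?thesis .
qed

lemma of_real_scalar_mult_vec: "complex_of_real l *s v = l *\<^sub>R v"
  by (auto simp: vec_eq_iff scaleR_conv_of_real[where 'a = complex])

lemma linear_matrix_vector_mult_complex: "linear ((*v) (A :: complex ^ 'n ^ 'm))"
  by (rule linearI)
    (simp_all add: vec_eq_iff matrix_vector_mult_def scaleR_sum_right sum.distrib distrib_left)

text \<open>The form of the Gram matrix at \<open>x\<close> is the squared norm of
  \<open>A *v x\<close>. Its top eigenvalue bounds this from above, while an eigenvector for an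
  eigenvalue \<open>m\<close> is stretched by exactly \<open>sqrt m\<close>.\<close>

lemma
  fixes A :: "complex ^ 'n ^ 'm"
  shows norm_le_sigma_max: "norm (A *v x) \<le> sigma_max A * norm x"
    and sigma_max_le: "(\<And>x. norm (A *v x) \<le> B * norm x) \<Longrightarrow> sigma_max A \<le> B"
proof -
  let ?T = "\<lambda>x. (conj_transpose A ** A) *v x"
  let ?L = "{l :: real. eigenvalue (conj_transpose A ** A) (complex_of_real l)}"
  have S: "{sqrt l | l :: real. eigenvalue (conj_transpose A ** A) (complex_of_real l)} = sqrt ` ?L"
    by auto
  have inner_T: "inner x (?T y) = inner (A *v x) (A *v y)" for x y
    by (simp add: inner_conj_transpose flip: matrix_vector_mul_assoc)
  then have sa: "inner x (?T y) = inner (?T x) y" for x y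
    by (metis inner_commute)
  have L: "?L = {l. \<exists>v. v \<noteq> 0 \<and> ?T v = l *\<^sub>R v}"
    by (simp add: eigenvalue_def of_real_scalar_mult_vec)
  have fin: "finite (sqrt ` ?L)"
    unfolding L by (intro finite_imageI finite_selfadjoint_eigenvalues sa)
  obtain l v where v: "v \<noteq> 0" "?T v = l *\<^sub>R v" and top: "\<And>x. inner x (?T x) \<le> l * (norm x)\<^sup>2"
    using selfadjoint_top_eigenvalue[OF linear_matrix_vector_mult_complex sa] by metis
  have lL: "l \<in> ?L" unfolding L using v by blast
  have "sqrt l \<le> sigma_max A"
    unfolding sigma_max_def S using lL fin by (intro Max_ge) auto
  moreover have "norm (A *v x) \<le> sqrt l * norm x"
    using real_sqrt_le_mono[OF top[of x]] unfolding inner_T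
    by (simp add: real_sqrt_mult flip: norm_eq_sqrt_inner)
  ultimately show "norm (A *v x) \<le> sigma_max A * norm x"
    by (meson mult_right_mono norm_ge_zero order_trans)
  show "sigma_max A \<le> B" if B: "\<And>x. norm (A *v x) \<le> B * norm x"
    unfolding sigma_max_def S
  proof (rule Max.boundedI[OF fin])
    show "sqrt ` ?L \<noteq> {}" using lL by blast
    fix a assume "a \<in> sqrt ` ?L"
    then obtain m u where a: "a = sqrt m" and u: "u \<noteq> 0" "?T u = m *\<^sub>R u" unfolding L by auto
    have "(norm (A *v u))\<^sup>2 = m * (norm u)\<^sup>2"
      using inner_T[of u u] u by (simp add: power2_norm_eq_inner)
    then have "sqrt ((norm (A *v u))\<^sup>2) = sqrt (m * (norm u)\<^sup>2)" by (rule arg_cong)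
    then have "norm (A *v u) = a * norm u" by (simp add: a real_sqrt_mult)
    then show "a \<le> B" using B[of u] u(1) by simp
  qed
qed

subsection \<open>Weighted Laplacians\<close>

text \<open>Real inner products are used throughout, also on complex vectors: \<open>inner v (M v)\<close> is the real part of
  the numerical range of \<open>M\<close>.\<close>

definition lap :: "('n::finite \<times> 'n) set \<Rightarrow> ('n \<Rightarrow> 'n \<Rightarrow> real) \<Rightarrow> 'a::real_vector ^ 'n \<Rightarrow> 'a ^ 'n" where
  "lap E w v = (\<chi> i. \<Sum>k | (i, k) \<in> E. w i k *\<^sub>R (v $ i - v $ k))"

lemma linear_lap: "linear (lap E w)"
  by (rule linearI)
    (simp_all add: lap_def vec_eq_iff scaleR_sum_right scaleR_diff_right scaleR_add_right
      mult.commute add_diff_add sum.distrib)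

text \<open>Common source of the real and the complex matrix product; \<open>lap\<close> lives over
  any real vector space so that both can share it. Irreflexivity matters because a self-loop would
  count in the diagonal entry of \<open>laplacian\<close> but cancel in \<open>lap\<close>.\<close>

lemma laplacian_scaleR:
  assumes "irrefl E"
  shows "(\<Sum>j\<in>UNIV. laplacian E w $ i $ j *\<^sub>R v $ j) = lap E w v $ i"
proof -
  have "(\<Sum>j\<in>UNIV. laplacian E w $ i $ j *\<^sub>R v $ j) =
      (\<Sum>j\<in>UNIV. (if i = j then (\<Sum>k | (i, k) \<in> E. w i k) *\<^sub>R v $ j else 0)
        - (if (i, j) \<in> E then w i j *\<^sub>R v $ j else 0))"
    using assms by (intro sum.cong) (auto simp: laplacian_def irrefl_def)
  also have "\<dots> = (\<Sum>k | (i, k) \<in> E. w i k) *\<^sub>R v $ i - (\<Sum>k | (i, k) \<in> E. w i k *\<^sub>R v $ k)"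
    by (simp add: sum_subtractf sum.If_cases)
  finally show ?thesis
    by (simp add: lap_def scaleR_diff_right sum_subtractf scaleR_sum_left)
qed

lemma laplacian_mult_vec:
  assumes "irrefl E"
  shows "laplacian E w *v v = lap E w v"
  by (simp add: vec_eq_iff matrix_vector_mult_def flip: laplacian_scaleR[OF assms])

lemma complex_matrix_laplacian_mult_vec:
  assumes "irrefl E"
  shows "complex_matrix (laplacian E w) *v v = lap E w v"
  by (simp add: vec_eq_iff matrix_vector_mult_def complex_matrix_def
      scaleR_conv_of_real[where 'a = complex] flip: laplacian_scaleR[OF assms])

text \<open>Summation by parts: \<open>E\<close> holds each edge in both orientations with equal
  weights, so the sum may be averaged with its reversed copy. The factor 1/2 corrects for the double
  count.\<close>

lemma inner_lap:
  fixes u v :: "'a::real_inner ^ 'n::finite"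
  assumes "weighted_graph E w"
  shows "inner u (lap E w v) = (\<Sum>(i, k)\<in>E. w i k * inner (u $ i - u $ k) (v $ i - v $ k)) / 2"
proof -
  have w: "w k i = w i k" if "(i, k) \<in> E" for i k
    using assms that unfolding weighted_graph_def by fastforce
  have sym: "sym E" using assms by (simp add: weighted_graph_def)
  have 1: "inner u (lap E w v) = (\<Sum>(i, k)\<in>E. w i k * inner (u $ i) (v $ i - v $ k))"
  proof -
    have "inner u (lap E w v) = (\<Sum>i\<in>UNIV. \<Sum>k | (i, k) \<in> E. w i k * inner (u $ i) (v $ i - v $ k))"
      by (simp add: inner_vec_def lap_def inner_sum_right)
    also have "\<dots> = (\<Sum>(i, k)\<in>(SIGMA i:UNIV. {k. (i, k) \<in> E}). w i k * inner (u $ i) (v $ i - v $ k))"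
      by (rule sum.Sigma) auto
    also have "(SIGMA i:UNIV. {k. (i, k) \<in> E}) = E" by auto
    finally show ?thesis .
  qed
  also have "\<dots> = (\<Sum>(i, k)\<in>E. w i k * inner (- u $ k) (v $ i - v $ k))"
    by (rule sum.reindex_bij_witness[of _ prod.swap prod.swap])
      (use sym in \<open>auto simp: w inner_diff_right sym_def\<close>)
  finally have "2 * inner u (lap E w v) = (\<Sum>(i, k)\<in>E. w i k * inner (u $ i) (v $ i - v $ k))
      + (\<Sum>(i, k)\<in>E. w i k * inner (- u $ k) (v $ i - v $ k))"
    using 1 by simp
  also have "\<dots> = (\<Sum>(i, k)\<in>E. w i k * inner (u $ i - u $ k) (v $ i - v $ k))"
    by (simp add: split_def inner_diff_left algebra_simps flip: sum.distrib)
  finally show ?thesis by simp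
qed

lemma lap_selfadjoint:
  fixes u v :: "'a::real_inner ^ 'n::finite"
  assumes "weighted_graph E w"
  shows "inner u (lap E w v) = inner (lap E w u) v"
  unfolding inner_commute[of "lap E w u"] inner_lap[OF assms]
  by (simp add: inner_commute)

lemma weighted_graph_pos: "weighted_graph E w \<Longrightarrow> (i, k) \<in> E \<Longrightarrow> w i k > 0"
  unfolding weighted_graph_def by auto

lemma inner_lap_nonneg:
  fixes v :: "'a::real_inner ^ 'n::finite"
  assumes "weighted_graph E w"
  shows "inner v (lap E w v) \<ge> 0"
  unfolding inner_lap[OF assms]
  by (intro divide_nonneg_pos sum_nonneg) (auto dest: weighted_graph_pos[OF assms] intro!: mult_nonneg_nonneg)

lemma inner_lap_eq_0D:
  fixes v :: "'a::real_inner ^ 'n::finite"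
  assumes "weighted_graph E w" "inner v (lap E w v) = 0" "(i, k) \<in> E"
  shows "v $ i = v $ k"
proof -
  have "\<forall>p\<in>E. (case p of (i, k) \<Rightarrow> w i k * inner (v $ i - v $ k) (v $ i - v $ k)) = 0"
    using assms(2) unfolding inner_lap[OF assms(1)]
    by (subst (asm) divide_eq_0_iff, subst (asm) sum_nonneg_eq_0_iff)
      (auto dest: weighted_graph_pos[OF assms(1)] intro!: mult_nonneg_nonneg)
  then show ?thesis using assms(3) weighted_graph_pos[OF assms(1,3)] by fastforce
qed

lemma laplacian_eigenvalues:
  fixes w :: "'n::finite \<Rightarrow> 'n \<Rightarrow> real"
  assumes "weighted_graph E w"
  shows "{l. eigenvalue (laplacian E w) l} = {l. \<exists>v :: real ^ 'n. v \<noteq> 0 \<and> lap E w v = l *\<^sub>R v}"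
proof -
  have "irrefl E" using assms by (simp add: weighted_graph_def)
  then show ?thesis
    by (simp add: eigenvalue_def laplacian_mult_vec scalar_mult_eq_scaleR)
qed

lemma finite_laplacian_eigenvalues:
  assumes "weighted_graph E w"
  shows "finite {l. eigenvalue (laplacian E w) l}"
  unfolding laplacian_eigenvalues[OF assms]
  by (rule finite_selfadjoint_eigenvalues) (rule lap_selfadjoint[OF assms])

lemma inner_lap_le_lambda_max:
  fixes x :: "real ^ 'n::finite"
  assumes "weighted_graph E w"
  shows "inner x (lap E w x) \<le> lambda_max E w * (norm x)\<^sup>2"
proof -
  obtain l and v :: "real ^ 'n" where "v \<noteq> 0" "lap E w v = l *\<^sub>R v"
    and l: "\<And>x :: real ^ 'n. inner x (lap E w x) \<le> l * (norm x)\<^sup>2"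
    using selfadjoint_top_eigenvalue[OF linear_lap lap_selfadjoint[OF assms]] by metis
  then have "l \<in> {l. eigenvalue (laplacian E w) l}" unfolding laplacian_eigenvalues[OF assms] by blast
  then have "l \<le> lambda_max E w"
    unfolding lambda_max_def by (intro Max_ge finite_laplacian_eigenvalues assms)
  then show ?thesis using l[of x] by (meson mult_right_mono order_trans zero_le_power2)
qed

text \<open>\<open>lambda_max\<close> comes from real eigenvectors, but the weights are real, so the
  form splits into those of the real and imaginary parts.\<close>

lemma inner_lap_le_lambda_max_complex:
  fixes x :: "complex ^ 'n::finite"
  assumes "weighted_graph E w"
  shows "inner x (lap E w x) \<le> lambda_max E w * (norm x)\<^sup>2"
proof -
  define a b :: "real ^ 'n" where "a = (\<chi> i. Re (x $ i))" and "b = (\<chi> i. Im (x $ i))"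
  have "inner x (lap E w x) = inner a (lap E w a) + inner b (lap E w b)"
    unfolding inner_lap[OF assms]
    by (simp add: a_def b_def inner_complex_def split_def distrib_left sum.distrib add_divide_distrib)
  also have "\<dots> \<le> lambda_max E w * ((norm a)\<^sup>2 + (norm b)\<^sup>2)"
    using inner_lap_le_lambda_max[OF assms, of a] inner_lap_le_lambda_max[OF assms, of b]
    by (simp add: distrib_left)
  also have "(norm a)\<^sup>2 + (norm b)\<^sup>2 = (norm x)\<^sup>2"
    by (simp add: a_def b_def power2_norm_eq_inner inner_vec_def inner_complex_def sum.distrib)
  finally show ?thesis .
qed

text \<open>Cauchy-Schwarz for the Laplacian form, applied to \<open>lap E w v\<close> and
  \<open>v\<close>, followed by cancelling the squared norm of \<open>lap E w v\<close>.\<close>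

lemma norm_lap_square_le:
  fixes v :: "complex ^ 'n::finite"
  assumes "weighted_graph E w"
  shows "(norm (lap E w v))\<^sup>2 \<le> lambda_max E w * inner v (lap E w v)"
proof (cases "lap E w v = 0")
  case False
  let ?T = "lap E w"
  have "(inner (?T v) (?T v))\<^sup>2 \<le> inner (?T v) (?T (?T v)) * inner v (?T v)"
    by (rule psd_cauchy_schwarz[OF linear_lap lap_selfadjoint[OF assms] inner_lap_nonneg[OF assms]])
  also have "\<dots> \<le> (lambda_max E w * (norm (?T v))\<^sup>2) * inner v (?T v)"
    by (intro mult_right_mono inner_lap_le_lambda_max_complex inner_lap_nonneg assms)
  finally have "(norm (?T v))\<^sup>2 * (norm (?T v))\<^sup>2 \<le> (norm (?T v))\<^sup>2 * (lambda_max E w * inner v (?T v))"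
    by (simp add: power2_norm_eq_inner[symmetric] power2_eq_square algebra_simps)
  then show ?thesis using False by (subst (asm) mult_le_cancel_left_pos) auto
qed simp

section \<open>Spectra of single subnetworks\<close>

lemma weighted_graph_subnet: "weighted_graph E w \<Longrightarrow> weighted_graph (subnet_edges E C) w"
  unfolding weighted_graph_def subnet_edges_def sym_def irrefl_def by auto

lemma subnetworks_edge:
  assumes "C \<in> subnetworks E"
  obtains i k where "(i, k) \<in> E" "i \<in> C" "k \<in> C"
proof -
  obtain x where C: "C = E\<^sup>* `` {x}" and "card C \<ge> 2"
    using assms by (auto simp: subnetworks_def quotient_def)
  have "C \<noteq> {x}" using \<open>card C \<ge> 2\<close> by auto
  then obtain y where "y \<noteq> x" "(x, y) \<in> E\<^sup>*" unfolding C by blast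
  then obtain z where "(x, z) \<in> E" by (metis converse_rtranclE)
  then show ?thesis using that[of x z] C by blast
qed

text \<open>Dropping edges can only decrease the Laplacian form; this is tested on an eigenvector of
  the subnetwork. The result shows that the eigenvalue ratio in condition 7 is at most 1.\<close>

lemma lambda_min_le_lambda_max:
  fixes w :: "'n::finite \<Rightarrow> 'n \<Rightarrow> real"
  assumes E: "weighted_graph E w" and C: "C \<in> subnetworks E"
  shows "lambda_min E w C \<le> lambda_max E w" "lambda_max E w > 0"
proof -
  let ?F = "subnet_edges E C"
  have F: "weighted_graph ?F w" by (rule weighted_graph_subnet[OF E])
  obtain i k where ik: "(i, k) \<in> E" "i \<in> C" "k \<in> C" by (rule subnetworks_edge[OF C])
  then have ikF: "(i, k) \<in> ?F" by (simp add: subnet_edges_def)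
  have "i \<noteq> k" using ik E by (auto simp: weighted_graph_def irrefl_def)
  obtain l and v :: "real ^ 'n" where v: "v \<noteq> 0" "lap ?F w v = l *\<^sub>R v"
    and l: "\<And>x :: real ^ 'n. inner x (lap ?F w x) \<le> l * (norm x)\<^sup>2"
    using selfadjoint_top_eigenvalue[OF linear_lap lap_selfadjoint[OF F]] by metis
  \<comment> \<open>A unit vector separates the ends of the edge, so its form is not zero. Hence the
    top eigenvalue is nonzero, and the set minimised in \<open>lambda_min\<close> is not
    empty.\<close>
  have "inner (axis i 1 :: real ^ 'n) (lap ?F w (axis i 1)) \<noteq> 0"
    using inner_lap_eq_0D[OF F _ ikF, of "axis i 1 :: real ^ 'n"] \<open>i \<noteq> k\<close> by (auto simp: axis_def)
  then have "l \<noteq> 0" using l[of "axis i 1"] inner_lap_nonneg[OF F, of "axis i 1 :: real ^ 'n"] by auto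
  let ?L = "{l. eigenvalue (laplacian ?F w) l \<and> l \<noteq> 0}"
  have "l \<in> ?L" using v \<open>l \<noteq> 0\<close> laplacian_eigenvalues[OF F] by blast
  moreover have "finite ?L" by (rule finite_subset[OF _ finite_laplacian_eigenvalues[OF F]]) auto
  ultimately have "lambda_min E w C \<in> ?L" unfolding lambda_min_def by (intro Min_in) auto
  then have "lambda_min E w C \<noteq> 0" and "lambda_min E w C \<in> {l. eigenvalue (laplacian ?F w) l}" by auto
  then obtain u :: "real ^ 'n" where u: "u \<noteq> 0" "lap ?F w u = lambda_min E w C *\<^sub>R u"
    unfolding laplacian_eigenvalues[OF F] by auto
  then have eq: "inner u (lap ?F w u) = lambda_min E w C * (norm u)\<^sup>2" by (simp add: power2_norm_eq_inner)
  have pos: "lambda_min E w C > 0"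
    using inner_lap_nonneg[OF F, of u] \<open>lambda_min E w C \<noteq> 0\<close> u(1) unfolding eq
    by (simp add: zero_le_mult_iff)
  have nonneg: "0 \<le> w i k * inner (u $ i - u $ k) (u $ i - u $ k)" if "(i, k) \<in> E" for i k
    by (intro mult_nonneg_nonneg inner_ge_zero less_imp_le weighted_graph_pos[OF E that])
  have "inner u (lap ?F w u) \<le> inner u (lap E w u)"
    unfolding inner_lap[OF F] inner_lap[OF E]
    by (intro divide_right_mono sum_mono2)
      (auto simp: subnet_edges_def simp del: inner_real_def intro!: nonneg)
  also have "\<dots> \<le> lambda_max E w * (norm u)\<^sup>2" by (rule inner_lap_le_lambda_max[OF E])
  finally show "lambda_min E w C \<le> lambda_max E w" unfolding eq using u(1) by simp
  then show "lambda_max E w > 0" using pos by simp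
qed

subsection \<open>Real-rational functions on the right half-plane\<close>

abbreviation cpoly :: "real poly \<Rightarrow> complex poly" where
  "cpoly \<equiv> map_poly of_real"

text \<open>Because \<open>x / 0 = 0\<close>, inverting the fraction is valid at every point,
  including zeros of \<open>p\<close> and \<open>q\<close>. Here \<open>p\<close> may still be the
  zero polynomial.\<close>

lemma transfer_function_inverse:
  assumes "transfer_function f"
  obtains q p where "coprime p q" "\<And>s. 1 / f s = poly (cpoly q) s / poly (cpoly p) s"
  using assms unfolding transfer_function_def by force

lemma poly_cpoly_of_real: "poly (cpoly p) (complex_of_real x) = of_real (poly p x)"
  by (induction p) (simp_all add: map_poly_pCons)

text \<open>Comparison of degrees; a finite limit is 0 or the ratio of the leading coefficients,
  hence real.\<close>

lemma rational_limit_at_infinity: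
  fixes p q :: "real poly"
  assumes "q \<noteq> 0"
  shows "filterlim (\<lambda>s. poly (cpoly p) s / poly (cpoly q) s) at_infinity at_infinity \<or>
    (\<exists>a. ((\<lambda>s. poly (cpoly p) s / poly (cpoly q) s) \<longlongrightarrow> complex_of_real a) at_infinity)"
proof -
  let ?P = "cpoly p" and ?Q = "cpoly q"
  have lead: "lead_coeff (cpoly r) = of_real (lead_coeff r)" for r
    by (simp add: coeff_map_poly degree_map_poly)
  have Q: "?Q \<noteq> 0" using assms by (simp add: map_poly_eq_0_iff)
  consider "degree ?P < degree ?Q" | "degree ?P = degree ?Q" | "degree ?P > degree ?Q" by linarith
  then show ?thesis
  proof cases
    case 1
    then show ?thesis using poly_divide_tendsto_0_at_infinity[OF 1] by (auto intro!: exI[of _ 0])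
  next
    case 2
    have "((\<lambda>s. (poly ?P s / s ^ degree ?P) / (poly ?Q s / s ^ degree ?Q)) \<longlongrightarrow> lead_coeff ?P / lead_coeff ?Q) at_infinity"
      using Q by (intro tendsto_divide poly_divide_tendsto_aux) auto
    moreover have "eventually (\<lambda>s. (poly ?P s / s ^ degree ?P) / (poly ?Q s / s ^ degree ?Q) = poly ?P s / poly ?Q s) at_infinity"
      by (rule eventually_at_infinityI[of 1]) (auto simp: 2)
    ultimately have "((\<lambda>s. poly ?P s / poly ?Q s) \<longlongrightarrow> of_real (lead_coeff p / lead_coeff q)) at_infinity"
      unfolding lead by (simp add: tendsto_cong)
    then show ?thesis by blast
  next
    case 3
    then have P: "?P \<noteq> 0" by auto
    have "((\<lambda>s. poly ?Q s / poly ?P s) \<longlongrightarrow> 0) at_infinity"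
      by (rule poly_divide_tendsto_0_at_infinity[OF 3])
    \<comment> \<open>The inverse diverges only if 0 is approached without being attained; the
      finitely many roots are left behind.\<close>
    moreover have "eventually (\<lambda>s. poly ?Q s / poly ?P s \<noteq> 0) at_infinity"
    proof -
      have "finite {s. poly (?P * ?Q) s = 0}" using P Q by (intro poly_roots_finite) simp
      then obtain B where "\<And>s. poly (?P * ?Q) s = 0 \<Longrightarrow> norm s \<le> B"
        by (metis (mono_tags) bounded_iff finite_imp_bounded mem_Collect_eq)
      then show ?thesis
        by (intro eventually_at_infinityI[of "B + 1"]) fastforce
    qed
    ultimately have "filterlim (\<lambda>s. inverse (poly ?Q s / poly ?P s)) at_infinity at_infinity"
      by (intro filterlim_compose[OF filterlim_inverse_at_infinity]) (simp add: filterlim_at)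
    then show ?thesis by simp
  qed
qed

text \<open>Continuity amounts to \<open>p\<close> having no root in the closed half-plane. Away
  from 0 a root would be a zero of \<open>f\<close>; at 0 it would be a genuine pole of
  \<open>1 / f\<close>, since the fraction is in lowest terms, against the bound nearby.\<close>

lemma transfer_function_inverse_continuous:
  assumes f: "transfer_function f"
    and nz: "\<And>s. Re s \<ge> 0 \<Longrightarrow> s \<noteq> 0 \<Longrightarrow> f s \<noteq> 0"
    and bd: "\<delta> > 0" "\<And>s. Re s > 0 \<Longrightarrow> norm s < \<delta> \<Longrightarrow> norm (1 / f s) \<le> B"
  shows "continuous_on {s. Re s \<ge> 0} (\<lambda>s. 1 / f s)"
proof -
  obtain q p where cop: "coprime p q"
    and eq: "\<And>s. 1 / f s = poly (cpoly q) s / poly (cpoly p) s"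
    by (rule transfer_function_inverse[OF f]) (rule that)
  have "poly (cpoly p) 0 \<noteq> 0"
  proof
    assume p0: "poly (cpoly p) 0 = 0"
    then have p0': "poly p 0 = 0" using poly_cpoly_of_real[of p 0] by simp
    have "poly q 0 \<noteq> 0"
    proof
      assume "poly q 0 = 0"
      with p0' have "[:0, 1:] dvd p" "[:0, 1:] dvd q" by (simp_all add: dvd_iff_poly_eq_0)
      then have "is_unit [:0, 1 :: real:]" using cop by (meson not_coprimeI)
      then show False by (simp add: is_unit_pCons_iff)
    qed
    have lim: "((\<lambda>x. poly r (x::real)) \<longlongrightarrow> poly r 0) (at_right 0)" for r
      by (intro tendsto_intros)
    have "((\<lambda>x. B * \<bar>poly p x\<bar>) \<longlongrightarrow> B * \<bar>poly p 0\<bar>) (at_right 0)"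
      "((\<lambda>x. \<bar>poly q x\<bar>) \<longlongrightarrow> \<bar>poly q 0\<bar>) (at_right 0)"
      by (intro tendsto_intros lim)+
    \<comment> \<open>The bound cleared of its denominator survives the limit and gives
      \<open>poly q 0 = 0\<close>.\<close>
    moreover have "eventually (\<lambda>x. \<bar>poly q x\<bar> \<le> B * \<bar>poly p x\<bar>) (at_right (0::real))"
      unfolding eventually_at_right_field
    proof (intro exI[of _ \<delta>] conjI allI impI bd(1))
      fix x :: real assume x: "0 < x" "x < \<delta>"
      then have nzp: "poly p x \<noteq> 0"
        using nz[of "of_real x"] eq[of "of_real x"] by (auto simp: poly_cpoly_of_real)
      have "\<bar>poly q x / poly p x\<bar> \<le> B"
        using bd(2)[of "of_real x"] x unfolding eq poly_cpoly_of_real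
        by (simp flip: of_real_divide)
      then show "\<bar>poly q x\<bar> \<le> B * \<bar>poly p x\<bar>" using nzp by (simp add: field_simps)
    qed
    ultimately have "\<bar>poly q 0\<bar> \<le> B * \<bar>poly p 0\<bar>"
      by (intro tendsto_le[of "at_right 0"]) auto
    then show False using \<open>poly q 0 \<noteq> 0\<close> p0' by simp
  qed
  moreover have "poly (cpoly p) s \<noteq> 0" if "Re s \<ge> 0" "s \<noteq> 0" for s
    using nz[OF that] eq[of s] by auto
  ultimately show ?thesis
    unfolding eq by (intro continuous_intros) (metis mem_Collect_eq)
qed

text \<open>Boundedness leaves only a finite real limit. The sign claim is conditional because
  positivity at 0 is available only for buses with a DC line.\<close>

lemma transfer_function_inverse_limit_nonneg:
  assumes f: "transfer_function f"
    and nz: "\<And>s. Re s \<ge> 0 \<Longrightarrow> s \<noteq> 0 \<Longrightarrow> f s \<noteq> 0"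
    and bd: "\<And>s. Re s > 0 \<Longrightarrow> norm (1 / f s) \<le> B"
  obtains a where "((\<lambda>s. 1 / f s) \<longlongrightarrow> complex_of_real a) at_infinity" "Re (1 / f 0) > 0 \<longrightarrow> a \<ge> 0"
proof -
  obtain q p where eq: "\<And>s. 1 / f s = poly (cpoly q) s / poly (cpoly p) s"
    by (rule transfer_function_inverse[OF f]) (rule that)
  have "p \<noteq> 0" using nz[of 1] eq[of 1] by auto
  have real_inf: "filterlim complex_of_real at_infinity at_top"
    by (rule filterlim_of_real_at_infinity)
  have "\<not> filterlim (\<lambda>s. 1 / f s) at_infinity at_infinity"
  proof
    assume "filterlim (\<lambda>s. 1 / f s) at_infinity at_infinity"
    then have "filterlim (\<lambda>x. 1 / f (complex_of_real x)) at_infinity at_top"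
      using real_inf by (rule filterlim_compose)
    then have "eventually (\<lambda>x. norm (1 / f (complex_of_real x)) \<ge> B + 1) at_top"
      by (intro filterlim_at_top[THEN iffD1, rule_format] filterlim_at_infinity_imp_norm_at_top)
    then have "eventually (\<lambda>x::real. False) at_top"
      using eventually_gt_at_top[of 0]
    proof eventually_elim
      case (elim x)
      then show ?case using bd[of "of_real x"] by simp
    qed
    then show False by simp
  qed
  then obtain a where a: "((\<lambda>s. 1 / f s) \<longlongrightarrow> complex_of_real a) at_infinity"
    using rational_limit_at_infinity[OF \<open>p \<noteq> 0\<close>, of q] unfolding eq by blast
  have "a \<ge> 0" if pos: "Re (1 / f 0) > 0"
  proof (rule ccontr)
    assume "\<not> a \<ge> 0"
    define h where "h x = Re (1 / f (complex_of_real x))" for x :: real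
    have f_h: "1 / f (complex_of_real x) = of_real (h x)" for x
      unfolding h_def eq poly_cpoly_of_real by (simp flip: of_real_divide)
    have "((\<lambda>x. 1 / f (complex_of_real x)) \<longlongrightarrow> complex_of_real a) at_top"
      by (rule filterlim_compose[OF a real_inf])
    then have "(h \<longlongrightarrow> a) at_top" unfolding h_def using tendsto_Re by fastforce
    then have "eventually (\<lambda>x. h x < 0) at_top"
      using \<open>\<not> a \<ge> 0\<close> by (intro order_tendstoD(2)) auto
    then obtain y where y: "y > 0" "h y < 0"
      using eventually_happens[OF eventually_conj[OF _ eventually_gt_at_top[of 0]]] by force
    have "continuous_on {0..y} h"
    proof -
      have "continuous_on {s. Re s \<ge> 0} (\<lambda>s. 1 / f s)"
        by (rule transfer_function_inverse_continuous[OF f nz zero_less_one]) (use bd in auto)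
      moreover have "continuous_on {0..y} complex_of_real"
        by (intro continuous_intros)
      ultimately have "continuous_on {0..y} (\<lambda>x. 1 / f (complex_of_real x))"
        by (rule continuous_on_compose2) auto
      then show ?thesis unfolding h_def by (rule continuous_on_Re)
    qed
    \<comment> \<open>A sign change of \<open>h\<close> on the axis would produce a zero of
      \<open>f\<close> at a positive point.\<close>
    then obtain x where x: "0 \<le> x" "x \<le> y" "h x = 0"
      using IVT2'[of h y 0 0] y pos by (force simp: h_def)
    then have "x \<noteq> 0" using pos by (auto simp: h_def)
    then show False using nz[of "of_real x"] f_h[of x] x by auto
  qed
  then show ?thesis using that a by blast
qed

subsection \<open>The closed-loop operator and its limits\<close>

lemma diag_mult_vec_nth [simp]: "(diag d *v v) $ i = d i * v $ i"
  by (simp add: diag_def matrix_vector_mult_def if_distrib[of "\<lambda>x. x * _"] sum.If_cases)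

lemma inner_mult_self: "inner z (c * z) = Re c * (norm z)\<^sup>2" for c z :: complex
  unfolding inner_complex_def cmod_power2 by (simp add: power2_eq_square algebra_simps)

lemma norm_diag_le:
  assumes "\<And>i. norm (d i) \<le> D"
  shows "norm (diag d *v v) \<le> D * norm v"
proof -
  have "D \<ge> 0" using assms norm_ge_zero order_trans by blast
  have "norm (diag d *v v) \<le> norm (D *\<^sub>R v)"
    by (rule norm_le_componentwise_cart)
      (use assms \<open>D \<ge> 0\<close> in \<open>auto simp: norm_mult intro: mult_right_mono\<close>)
  then show ?thesis using \<open>D \<ge> 0\<close> by simp
qed

lemma inner_lap_diag:
  assumes E: "weighted_graph E w" and m: "\<And>i k. (i, k) \<in> E \<Longrightarrow> m i = m k"
  shows "inner v (lap E w (diag m *v v)) = (\<Sum>(i, k)\<in>E. w i k * (Re (m i) * (norm (v $ i - v $ k))\<^sup>2)) / 2"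
proof -
  have "inner (v $ i - v $ k) (m i * v $ i - m k * v $ k) = Re (m i) * (norm (v $ i - v $ k))\<^sup>2"
    if "(i, k) \<in> E" for i k
    using inner_mult_self[of "v $ i - v $ k" "m i"] m[OF that] by (simp add: right_diff_distrib)
  then show ?thesis unfolding inner_lap[OF E] by (auto intro!: sum.cong)
qed

text \<open>Coefficients constant along edges factor out of the differences, and only their real
  parts reach the form. Used for the component means on the DC side and for the constant
  \<open>1 / s\<close> on the AC side.\<close>

lemma inner_lap_diag_ge:
  assumes E: "weighted_graph E w" and m: "\<And>i k. (i, k) \<in> E \<Longrightarrow> m i = m k"
    and ge: "\<And>i k. (i, k) \<in> E \<Longrightarrow> \<mu> \<le> Re (m i)"
  shows "\<mu> * inner v (lap E w v) \<le> inner v (lap E w (diag m *v v))"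
proof -
  have "\<mu> * inner v (lap E w v) = (\<Sum>(i, k)\<in>E. w i k * (\<mu> * (norm (v $ i - v $ k))\<^sup>2)) / 2"
    unfolding inner_lap[OF E] by (simp add: sum_distrib_left split_def power2_norm_eq_inner algebra_simps)
  also have "\<dots> \<le> inner v (lap E w (diag m *v v))"
    by (subst inner_lap_diag[OF E m], assumption, intro divide_right_mono sum_mono)
      (auto intro!: mult_left_mono mult_right_mono less_imp_le[OF weighted_graph_pos[OF E]] ge)
  finally show ?thesis .
qed

lemma tendsto_lap:
  fixes v :: "'b \<Rightarrow> 'a::euclidean_space ^ 'n::finite"
  assumes "(v \<longlongrightarrow> l) F"
  shows "((\<lambda>x. lap E w (v x)) \<longlongrightarrow> lap E w l) F"
  using linear_conv_bounded_linear[THEN iffD1, OF linear_lap] assms by (rule bounded_linear.tendsto)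

lemma tendsto_diag:
  assumes "\<And>i. ((\<lambda>x. d x i) \<longlongrightarrow> d' i) F" "(v \<longlongrightarrow> l) F"
  shows "((\<lambda>x. diag (d x) *v v x) \<longlongrightarrow> diag d' *v l) F"
  by (rule vec_tendstoI) (simp add: tendsto_mult tendsto_vec_nth assms)

text \<open>\<open>f\<close>, \<open>\<kappa>\<close> and \<open>z\<close> stand for the values of \<open>1 / (g\<^sub>i k\<^sub>i)\<close>, \<open>1 / k\<^sub>i\<close> and \<open>1 / s\<close>.\<close>

definition network_op ::
  "('n::finite \<times> 'n) set \<Rightarrow> ('n \<Rightarrow> 'n \<Rightarrow> real) \<Rightarrow> ('n \<times> 'n) set \<Rightarrow> ('n \<Rightarrow> 'n \<Rightarrow> real) \<Rightarrow>
    ('n \<Rightarrow> complex) \<Rightarrow> ('n \<Rightarrow> complex) \<Rightarrow> complex \<Rightarrow> complex ^ 'n \<Rightarrow> complex ^ 'n" where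
  "network_op Eac b Edc w f \<kappa> z v =
     diag f *v v + lap Edc w (diag \<kappa> *v v) + lap Eac b (diag (\<lambda>_. z) *v v)"

lemma tendsto_network_op:
  assumes "\<And>i. ((\<lambda>x. f x i) \<longlongrightarrow> f' i) F" "\<And>i. ((\<lambda>x. \<kappa> x i) \<longlongrightarrow> \<kappa>' i) F" "(z \<longlongrightarrow> z') F" "(v \<longlongrightarrow> v') F"
  shows "((\<lambda>x. network_op Eac b Edc w (f x) (\<kappa> x) (z x) (v x)) \<longlongrightarrow> network_op Eac b Edc w f' \<kappa>' z' v') F"
  unfolding network_op_def by (intro tendsto_add tendsto_lap tendsto_diag assms)

lemma Hinv_mult_vec:
  assumes "irrefl Eac" "irrefl Edc"
  shows "Hinv g k (laplacian Eac b) (laplacian Edc w) s *v v =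
    network_op Eac b Edc w (\<lambda>i. 1 / g i s * (1 / k i s)) (\<lambda>i. 1 / k i s) (1 / s) v"
proof -
  have "mat (1 / s) *v u = diag (\<lambda>_. 1 / s) *v u" for u :: "complex ^ 'a"
    by (simp add: mat_def diag_def)
  moreover have "diag (\<lambda>_. c) *v lap Eac b v = lap Eac b (diag (\<lambda>_. c) *v v)" for c
    by (simp add: vec_eq_iff lap_def sum_distrib_left algebra_simps)
  moreover have "diag c *v (diag d *v v) = diag (\<lambda>i. c i * d i) *v v" for c d
    by (simp add: vec_eq_iff)
  ultimately show ?thesis
    unfolding Hinv_def network_op_def diag_inv_def
    by (simp add: matrix_vector_mult_add_rdistrib complex_matrix_laplacian_mult_vec assms
        flip: matrix_vector_mul_assoc)
qed

section \<open>Numerical range of the closed-loop operator and kernels of its limits\<close>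

lemma inner_diag: "inner v (diag f *v v) = (\<Sum>i\<in>UNIV. Re (f i) * (norm (v $ i))\<^sup>2)"
  by (simp add: inner_vec_def inner_mult_self)

lemma inner_network_op:
  assumes dc: "weighted_graph Edc w"
  shows "inner v (network_op Eac b Edc w f \<kappa> z v) =
    inner v (diag f *v v) + inner v (lap Edc w (diag m *v v))
      + inner (lap Edc w v) (diag (\<lambda>i. \<kappa> i - m i) *v v) + inner v (lap Eac b (diag (\<lambda>_. z) *v v))"
proof -
  have "diag \<kappa> *v v = diag m *v v + diag (\<lambda>i. \<kappa> i - m i) *v v"
    by (simp add: vec_eq_iff algebra_simps)
  then show ?thesis
    unfolding network_op_def
    by (simp add: linear_add[OF linear_lap] inner_add_right lap_selfadjoint[OF dc, of v "diag (\<lambda>i. \<kappa> i - m i) *v v"])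
qed

text \<open>With \<open>x = norm v\<close> and \<open>y = norm (lap Edc w v)\<close> the real part
  is at least \<xi> \<open>x\<^sup>2\<close> + \<mu> \<open>y\<^sup>2 / l - D * x * y\<close>. The
  assumption \<open>bound\<close> says that this quadratic form has negative discriminant. The DC
  bounds are assumed only if DC lines exist.\<close>

lemma inner_network_op_pos:
  assumes ac: "weighted_graph Eac b" and dc: "weighted_graph Edc w"
    and z: "Re z \<ge> 0" and \<xi>: "\<xi> > 0" "\<And>i. \<xi> \<le> Re (f i)"
    and m: "\<And>i k. (i, k) \<in> Edc \<Longrightarrow> m i = m k"
    and \<mu>: "\<And>i k. (i, k) \<in> Edc \<Longrightarrow> \<mu> \<le> Re (m i)" "\<mu> \<ge> 0"
    and D: "\<And>i. Edc \<noteq> {} \<Longrightarrow> norm (\<kappa> i - m i) \<le> D"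
    and bound: "Edc \<noteq> {} \<Longrightarrow> lambda_max Edc w > 0" "Edc \<noteq> {} \<Longrightarrow> lambda_max Edc w * D\<^sup>2 < 4 * \<xi> * \<mu>"
    and v: "v \<noteq> 0"
  shows "inner v (network_op Eac b Edc w f \<kappa> z v) > 0"
proof -
  define x y where "x = norm v" and "y = norm (lap Edc w v)"
  have "x > 0" "y \<ge> 0" using v by (auto simp: x_def y_def)
  have f: "\<xi> * x\<^sup>2 \<le> inner v (diag f *v v)"
    by (auto simp: inner_diag x_def power2_norm_eq_inner[of v] inner_vec_def[of v] sum_distrib_left
        power2_norm_eq_inner intro!: sum_mono mult_right_mono \<xi>(2))
  have "0 * inner v (lap Eac b v) \<le> inner v (lap Eac b (diag (\<lambda>_. z) *v v))"
    using z by (intro inner_lap_diag_ge ac) auto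
  then have ac_nonneg: "inner v (lap Eac b (diag (\<lambda>_. z) *v v)) \<ge> 0" by simp
  show ?thesis
  proof (cases "Edc = {}")
    case True
    then have "lap Edc w u = 0" for u :: "complex ^ 'a" by (simp add: lap_def vec_eq_iff)
    then show ?thesis
      using f ac_nonneg mult_pos_pos[OF \<xi>(1), of "x\<^sup>2"] \<open>x > 0\<close>
      by (simp add: inner_network_op[OF dc, where m = m])
  next
    case False
    define l where "l = lambda_max Edc w"
    have l: "l > 0" "l * D\<^sup>2 < 4 * \<xi> * \<mu>" using bound False by (auto simp: l_def)
    have "\<mu> * (y\<^sup>2 / l) \<le> \<mu> * inner v (lap Edc w v)"
      using norm_lap_square_le[OF dc, of v] l \<mu>(2)
      by (intro mult_left_mono) (simp_all add: y_def l_def field_simps)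
    also have "\<dots> \<le> inner v (lap Edc w (diag m *v v))"
      by (intro inner_lap_diag_ge dc m \<mu>(1))
    finally have mean: "\<mu> * (y\<^sup>2 / l) \<le> inner v (lap Edc w (diag m *v v))" .
    have "\<bar>inner (lap Edc w v) (diag (\<lambda>i. \<kappa> i - m i) *v v)\<bar> \<le> y * norm (diag (\<lambda>i. \<kappa> i - m i) *v v)"
      unfolding y_def by (rule Cauchy_Schwarz_ineq2)
    also have "\<dots> \<le> y * (D * x)"
      unfolding x_def by (intro mult_left_mono norm_diag_le D False \<open>y \<ge> 0\<close>)
    finally have dev: "- (D * x * y) \<le> inner (lap Edc w v) (diag (\<lambda>i. \<kappa> i - m i) *v v)"
      by (simp add: algebra_simps)
    have "0 < \<xi> * x\<^sup>2 + \<mu> * (y\<^sup>2 / l) - D * x * y"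
    proof (cases "y = 0")
      case True
      then show ?thesis using \<xi>(1) \<open>x > 0\<close> by simp
    next
      case False
      \<comment> \<open>Completing the square in \<open>x\<close>, scaled by \<open>4 *\<close>
        \<xi>; the strict gain sits in the \<open>y\<^sup>2\<close> term, so \<open>y = 0\<close>
        was treated apart.\<close>
      have "D\<^sup>2 < 4 * \<xi> * \<mu> / l" using l by (simp add: field_simps)
      then have "0 < (4 * \<xi> * \<mu> / l - D\<^sup>2) * y\<^sup>2" using False by simp
      also have "\<dots> \<le> (2 * \<xi> * x - D * y)\<^sup>2 + (4 * \<xi> * \<mu> / l - D\<^sup>2) * y\<^sup>2" by simp
      also have "\<dots> = 4 * \<xi> * (\<xi> * x\<^sup>2 + \<mu> * (y\<^sup>2 / l) - D * x * y)"
        by (simp add: power2_eq_square algebra_simps)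
      finally show ?thesis using \<xi>(1) by (simp add: zero_less_mult_iff)
    qed
    then show ?thesis
      using f mean dev ac_nonneg by (simp add: inner_network_op[OF dc, where m = m])
  qed
qed

text \<open>The values \<kappa> and their component means \<open>m\<close> share the limit
  \<open>m'\<close>, so the deviation term disappears and the remaining real part is a sum of
  nonnegative terms.\<close>

lemma network_op_kernel_at_zero:
  fixes f \<kappa> m :: "nat \<Rightarrow> 'n::finite \<Rightarrow> complex"
  assumes ac: "weighted_graph Eac b" and dc: "weighted_graph Edc w"
    and conn: "graph_connected (Eac \<union> Edc)"
    and f: "\<And>i. (\<lambda>n. f n i) \<longlonglongrightarrow> f' i" "\<And>n i. Re (f n i) \<ge> 0" "(\<Sum>i\<in>UNIV. Re (f' i)) > 0"
    and m: "\<And>i. (\<lambda>n. m n i) \<longlonglongrightarrow> m' i" "\<And>n i k. (i, k) \<in> Edc \<Longrightarrow> m n i = m n k"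
      "\<And>i k. (i, k) \<in> Edc \<Longrightarrow> Re (m' i) > 0"
    and \<kappa>: "\<And>i. (\<lambda>n. \<kappa> n i) \<longlonglongrightarrow> m' i"
    and s: "s \<longlonglongrightarrow> 0" "\<And>n. Re (s n) > 0"
    and v: "v \<longlonglongrightarrow> v'"
    and lim: "(\<lambda>n. network_op Eac b Edc w (f n) (\<kappa> n) (1 / s n) (v n)) \<longlonglongrightarrow> 0"
  shows "v' = 0"
proof -
  let ?N = "\<lambda>n. network_op Eac b Edc w (f n) (\<kappa> n) (1 / s n) (v n)"
  \<comment> \<open>Multiplication by \<open>s n\<close> clears the singular factor, and in the
    limit only the AC Laplacian remains.\<close>
  have "(\<lambda>n. diag (\<lambda>_. s n) *v ?N n) \<longlonglongrightarrow> diag (\<lambda>_. 0) *v 0"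
    by (intro tendsto_diag s lim)
  moreover have "diag (\<lambda>_. s n) *v ?N n =
      network_op Eac b Edc w (\<lambda>i. s n * f n i) (\<lambda>i. s n * \<kappa> n i) 1 (v n)" for n
  proof -
    have "s n \<noteq> 0" using s(2)[of n] by auto
    then show ?thesis
      by (simp add: vec_eq_iff network_op_def lap_def sum_distrib_left algebra_simps)
  qed
  moreover have "(\<lambda>n. network_op Eac b Edc w (\<lambda>i. s n * f n i) (\<lambda>i. s n * \<kappa> n i) 1 (v n)) \<longlonglongrightarrow>
      network_op Eac b Edc w (\<lambda>i. 0 * f' i) (\<lambda>i. 0 * m' i) 1 v'"
    by (intro tendsto_network_op tendsto_intros s f \<kappa> v)
  ultimately have "network_op Eac b Edc w (\<lambda>i. 0 * f' i) (\<lambda>i. 0 * m' i) 1 v' = diag (\<lambda>_. 0) *v 0"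
    using LIMSEQ_unique by simp
  moreover have "diag (\<lambda>_. 0) *v u = 0" "diag (\<lambda>_. 1) *v u = u" for u :: "complex ^ 'n"
    by (simp_all add: vec_eq_iff)
  ultimately have "lap Eac b v' = 0"
    by (simp add: network_op_def linear_0[OF linear_lap])
  then have eq_ac: "v' $ i = v' $ k" if "(i, k) \<in> Eac" for i k
    using inner_lap_eq_0D[OF ac _ that, of v'] by simp

  \<comment> \<open>\<open>A\<close> omits the AC term, whose factor \<open>1 / s n\<close> blows
    up; that term is nonnegative, so \<open>A\<close> stays below a sequence tending to 0.\<close>
  define A where "A n = inner (v n) (diag (f n) *v v n) + inner (v n) (lap Edc w (diag (m n) *v v n))
      + inner (lap Edc w (v n)) (diag (\<lambda>i. \<kappa> n i - m n i) *v v n)" for n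
  have "A \<longlonglongrightarrow> inner v' (diag f' *v v') + inner v' (lap Edc w (diag m' *v v'))
      + inner (lap Edc w v') (diag (\<lambda>i. m' i - m' i) *v v')"
    unfolding A_def
    by (intro tendsto_add tendsto_inner tendsto_lap tendsto_diag tendsto_diff v f m \<kappa>)
  moreover have "diag (\<lambda>i. m' i - m' i) *v v' = 0" by (simp add: vec_eq_iff)
  ultimately have A: "A \<longlonglongrightarrow> inner v' (diag f' *v v') + inner v' (lap Edc w (diag m' *v v'))"
    by simp
  have "(\<lambda>n. inner (v n) (?N n)) \<longlonglongrightarrow> inner v' 0"
    by (intro tendsto_inner v lim)
  moreover have "A n \<le> inner (v n) (?N n)" for n
  proof -
    have "Re (1 / s n) \<ge> 0" using s(2)[of n] by (simp add: Re_divide divide_nonneg_nonneg)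
    then have "0 * inner (v n) (lap Eac b (v n)) \<le> inner (v n) (lap Eac b (diag (\<lambda>_. 1 / s n) *v v n))"
      by (intro inner_lap_diag_ge ac) auto
    then show ?thesis by (simp add: A_def inner_network_op[OF dc, where m = "m n"])
  qed
  ultimately have le0: "inner v' (diag f' *v v') + inner v' (lap Edc w (diag m' *v v')) \<le> 0"
    using A by (intro LIMSEQ_le[of A]) auto
  have f'0: "Re (f' i) \<ge> 0" for i
    by (rule LIMSEQ_le_const[OF tendsto_Re[OF f(1)]]) (use f(2) in auto)
  then have f'_nonneg: "inner v' (diag f' *v v') \<ge> 0"
    unfolding inner_diag by (intro sum_nonneg) simp
  have m': "m' i = m' k" if "(i, k) \<in> Edc" for i k
    using m(1)[of i] m(1)[of k] m(2)[OF that] LIMSEQ_unique by simp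
  obtain \<mu> where \<mu>: "\<mu> > 0" "\<And>i k. (i, k) \<in> Edc \<Longrightarrow> \<mu> \<le> Re (m' i)"
  proof
    \<comment> \<open>The extra element 1 keeps the set nonempty when there are no DC lines.\<close>
    let ?S = "insert 1 ((\<lambda>i. Re (m' i)) ` Domain Edc)"
    show "Min ?S > 0" using m(3) by (subst Min_gr_iff) auto
    show "Min ?S \<le> Re (m' i)" if "(i, k) \<in> Edc" for i k
      using that by (intro Min_le) auto
  qed
  have "\<mu> * inner v' (lap Edc w v') \<le> inner v' (lap Edc w (diag m' *v v'))"
    by (intro inner_lap_diag_ge dc m' \<mu>(2))
  moreover have "inner v' (lap Edc w v') \<ge> 0" by (rule inner_lap_nonneg[OF dc])
  moreover from this have "\<mu> * inner v' (lap Edc w v') \<ge> 0" using \<mu>(1) by simp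
  ultimately have "inner v' (diag f' *v v') = 0" "\<mu> * inner v' (lap Edc w v') = 0"
    using le0 f'_nonneg by linarith+
  then have *: "inner v' (diag f' *v v') = 0" "inner v' (lap Edc w v') = 0"
    using \<mu>(1) by auto
  have eq: "v' $ i = v' $ k" if "(i, k) \<in> Eac \<union> Edc" for i k
    using that eq_ac inner_lap_eq_0D[OF dc *(2)] by auto
  have const: "v' $ i = v' $ k" for i k
  proof -
    have "(i, k) \<in> (Eac \<union> Edc)\<^sup>*" using conn by (simp add: graph_connected_def)
    then show ?thesis by induction (use eq in auto)
  qed
  \<comment> \<open>On a constant vector the diagonal form is the sum of the real parts of
    \<open>f'\<close> times one squared modulus, and that sum is positive.\<close>
  have "(norm (v' $ i))\<^sup>2 * (\<Sum>j\<in>UNIV. Re (f' j)) = 0" for i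
  proof -
    have "inner v' (diag f' *v v') = (\<Sum>j\<in>UNIV. Re (f' j) * (norm (v' $ i))\<^sup>2)"
      unfolding inner_diag by (intro sum.cong refl) (metis const)
    then show ?thesis using *(1) by (simp add: sum_distrib_right mult.commute)
  qed
  then show ?thesis using f(3) by (simp add: vec_eq_iff)
qed

text \<open>The limit \<open>u\<close> of the vectors \<kappa> \<open>v\<close> has nonnegative DC
  form, whereas the limit equation makes each coordinate contribute a nonpositive amount. So all
  contributions vanish.\<close>

lemma network_op_kernel_at_infinity:
  fixes f \<kappa> :: "nat \<Rightarrow> 'n::finite \<Rightarrow> complex"
  assumes dc: "weighted_graph Edc w"
    and f: "\<And>i. filterlim (\<lambda>n. f n i) at_infinity sequentially \<or>
        (\<exists>a>0. (\<lambda>n. f n i) \<longlonglongrightarrow> complex_of_real a)"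
    and \<kappa>: "\<And>i. (\<lambda>n. \<kappa> n i) \<longlonglongrightarrow> complex_of_real (c i)" "\<And>i k. (i, k) \<in> Edc \<Longrightarrow> c i \<ge> 0"
    and z: "z \<longlonglongrightarrow> 0" and v: "v \<longlonglongrightarrow> v'"
    and lim: "(\<lambda>n. network_op Eac b Edc w (f n) (\<kappa> n) (z n) (v n)) \<longlonglongrightarrow> 0"
  shows "v' = 0"
proof -
  define u where "u = diag (\<lambda>i. complex_of_real (c i)) *v v'"
  define t where "t = lap Edc w u"
  have "(\<lambda>n. network_op Eac b Edc w (f n) (\<kappa> n) (z n) (v n)
        - (lap Edc w (diag (\<kappa> n) *v v n) + lap Eac b (diag (\<lambda>_. z n) *v v n)))
      \<longlonglongrightarrow> 0 - (t + lap Eac b (diag (\<lambda>_. 0) *v v'))"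
    unfolding t_def u_def by (intro tendsto_diff tendsto_add tendsto_lap tendsto_diag lim \<kappa> z v)
  moreover have "diag (\<lambda>_. 0) *v v' = 0" by (simp add: vec_eq_iff)
  ultimately have "(\<lambda>n. diag (f n) *v v n) \<longlonglongrightarrow> - t"
    by (simp add: network_op_def linear_0[OF linear_lap])
  then have fv: "(\<lambda>n. f n i * v n $ i) \<longlonglongrightarrow> - t $ i" for i
    using tendsto_vec_nth[of _ "- t" sequentially i] by fastforce
  \<comment> \<open>The products \<open>f n i * v n $ i\<close> converge, so a divergent
    \<open>f\<close> forces \<open>v' $ i = 0\<close>; otherwise the limit can be taken
    factorwise.\<close>
  have cases: "v' $ i = 0 \<or> (\<exists>a>0. t $ i = - (of_real a * v' $ i))" for i
    using f[of i]
  proof (elim disjE exE conjE)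
    assume inf: "filterlim (\<lambda>n. f n i) at_infinity sequentially"
    have "(\<lambda>n. f n i * v n $ i / f n i) \<longlonglongrightarrow> 0"
      by (rule tendsto_divide_0[OF fv inf])
    moreover have "eventually (\<lambda>n. f n i * v n $ i / f n i = v n $ i) sequentially"
      using filterlim_at_infinity_imp_eventually_ne[OF inf, of 0] by eventually_elim simp
    ultimately have "(\<lambda>n. v n $ i) \<longlonglongrightarrow> 0" by (simp add: tendsto_cong)
    then show ?thesis using LIMSEQ_unique tendsto_vec_nth[OF v] by blast
  next
    fix a :: real assume "a > 0" and a: "(\<lambda>n. f n i) \<longlonglongrightarrow> of_real a"
    have "(\<lambda>n. f n i * v n $ i) \<longlonglongrightarrow> of_real a * v' $ i"
      by (intro tendsto_mult a tendsto_vec_nth v)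
    then have "- t $ i = of_real a * v' $ i" using fv LIMSEQ_unique by blast
    then have "t $ i = - (of_real a * v' $ i)" by (metis minus_minus)
    then show ?thesis using \<open>a > 0\<close> by blast
  qed
  \<comment> \<open>The sign of \<open>c i\<close> is known only at buses with a DC line. At the
    others \<open>t $ i = 0\<close>, which settles the coordinate directly.\<close>
  have isolated: "v' $ i = 0" if "\<And>k. (i, k) \<notin> Edc" for i
    using cases[of i] that by (auto simp: t_def lap_def)
  have u0: "u $ i = 0 \<or> (\<exists>a>0. inner (u $ i) (t $ i) = - (a * c i * (norm (v' $ i))\<^sup>2) \<and> c i \<ge> 0)" for i
  proof (cases "v' $ i = 0")
    case False
    then obtain a where a: "a > 0" "t $ i = - (of_real a * v' $ i)" using cases by blast
    have "c i \<ge> 0" using isolated[of i] \<kappa>(2) False by blast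
    then show ?thesis using a
      by (intro disjI2 exI[of _ a]) (simp add: u_def cmod_power2 inner_complex_def, simp add: power2_eq_square algebra_simps)
  qed (simp add: u_def)
  have nonpos: "inner (u $ i) (t $ i) \<le> 0" for i
    using u0[of i] by auto
  have "inner u t \<ge> 0" unfolding t_def by (rule inner_lap_nonneg[OF dc])
  then have "(\<Sum>i\<in>UNIV. - inner (u $ i) (t $ i)) = 0"
    using nonpos by (intro order_antisym sum_nonneg) (auto simp: inner_vec_def sum_negf)
  then have "inner (u $ i) (t $ i) = 0" for i
    using nonpos by (subst (asm) sum_nonneg_eq_0_iff) auto
  then have "u $ i = 0" for i
    using u0[of i] by (auto simp: u_def)
  then have "u = 0" by (simp add: vec_eq_iff)
  then have "t = 0" by (simp add: t_def linear_0[OF linear_lap])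
  then have "v' $ i = 0" for i using cases[of i] by auto
  then show ?thesis by (simp add: vec_eq_iff)
qed

text \<open>Compactness of the unit sphere and of the closed half-plane completed by infinity. The
  failing sequence is sought first for large \<open>s\<close>, which fixes a radius
  \<open>N\<close>, and then inside that radius.\<close>

lemma uniform_lower_bound:
  fixes M :: "complex \<Rightarrow> 'a::euclidean_space \<Rightarrow> 'b::real_normed_vector"
  assumes lin: "\<And>s. linear (M s)"
    and inf: "\<And>s v v'. (\<And>n. Re (s n) > 0) \<Longrightarrow> filterlim s at_infinity sequentially \<Longrightarrow>
      v \<longlonglongrightarrow> v' \<Longrightarrow> (\<lambda>n. M (s n) (v n)) \<longlonglongrightarrow> 0 \<Longrightarrow> v' = 0"
    and fin: "\<And>s s' v v'. (\<And>n. Re (s n) > 0) \<Longrightarrow> s \<longlonglongrightarrow> s' \<Longrightarrow>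
      v \<longlonglongrightarrow> v' \<Longrightarrow> (\<lambda>n. M (s n) (v n)) \<longlonglongrightarrow> 0 \<Longrightarrow> v' = 0"
  obtains c where "c > 0" "\<And>s v. Re s > 0 \<Longrightarrow> c * norm v \<le> norm (M s v)"
proof -
  \<comment> \<open>\<open>P\<close> must become stronger with \<open>n\<close> so that passing to a
    subsequence, where indices only grow, preserves it.\<close>
  have sequence: "\<exists>s v v'. (\<forall>n. P n (s n)) \<and> v' \<noteq> 0 \<and> v \<longlonglongrightarrow> v' \<and> (\<lambda>n. M (s n) (v n)) \<longlonglongrightarrow> 0"
    if P: "\<And>m n s. m \<le> n \<Longrightarrow> P n s \<Longrightarrow> P m s"
      and ex: "\<And>n. \<exists>s v. P n s \<and> \<not> norm v / Suc n \<le> norm (M s v)" for P :: "nat \<Rightarrow> complex \<Rightarrow> bool"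
  proof -
    obtain s v where s: "\<And>n. P n (s n)" and v: "\<And>n. norm (M (s n) (v n)) < norm (v n) / Suc n"
      using ex unfolding not_le by metis
    define u where "u n = v n /\<^sub>R norm (v n)" for n
    have v0: "v n \<noteq> 0" for n using v[of n] norm_ge_zero[of "M (s n) (v n)"] by auto
    then have u: "norm (u n) = 1" for n by (simp add: u_def)
    have "norm (M (s n) (u n)) \<le> inverse (Suc n)" for n
      using v[of n] v0[of n] by (simp add: u_def linear_scale[OF lin] field_simps)
    then have Mu: "(\<lambda>n. M (s n) (u n)) \<longlonglongrightarrow> 0"
      by (intro Lim_null_comparison[OF always_eventually LIMSEQ_inverse_real_of_nat]) auto
    obtain v' r where v': "v' \<in> sphere 0 1" "strict_mono (r :: nat \<Rightarrow> nat)" "(u \<circ> r) \<longlonglongrightarrow> v'"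
      using compact_sphere[of 0 1, unfolded compact_def] u by (metis dist_0_norm mem_sphere)
    have "P n (s (r n))" for n using P[OF seq_suble[OF v'(2)] s] .
    moreover have "(\<lambda>n. M (s (r n)) (u (r n))) \<longlonglongrightarrow> 0"
      using LIMSEQ_subseq_LIMSEQ[OF Mu v'(2)] by (simp add: o_def)
    ultimately show ?thesis using v'
      by (intro exI[of _ "s \<circ> r"] exI[of _ "u \<circ> r"] exI[of _ v']) (auto simp: o_def)
  qed
  have "\<exists>N. \<forall>s v. Re s > 0 \<and> norm s \<ge> real N \<longrightarrow> norm v / Suc N \<le> norm (M s v)"
  proof (rule ccontr)
    assume "\<not> ?thesis"
    then have "\<And>n. \<exists>s v. (Re s > 0 \<and> norm s \<ge> real n) \<and> \<not> norm v / Suc n \<le> norm (M s v)" by blast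
    from sequence[OF _ this] obtain s v v' where s: "\<And>n. Re (s n) > 0 \<and> norm (s n) \<ge> real n"
      and v: "v' \<noteq> 0" "v \<longlonglongrightarrow> v'" "(\<lambda>n. M (s n) (v n)) \<longlonglongrightarrow> 0"
      by fastforce
    have "filterlim (\<lambda>n. norm (s n)) at_top sequentially"
      by (rule filterlim_at_top_mono[OF filterlim_real_sequentially]) (use s in auto)
    then have "filterlim s at_infinity sequentially" by (rule filterlim_norm_at_top_imp_at_infinity)
    then show False using inf[of s v v'] s v by blast
  qed
  then obtain N where N: "\<And>s v. Re s > 0 \<Longrightarrow> norm s \<ge> real N \<Longrightarrow> norm v / Suc N \<le> norm (M s v)"
    by blast
  have "\<exists>n. \<forall>s v. Re s > 0 \<and> norm s \<le> real N \<longrightarrow> norm v / Suc n \<le> norm (M s v)"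
  proof (rule ccontr)
    assume "\<not> ?thesis"
    then have "\<And>n. \<exists>s v. (Re s > 0 \<and> norm s \<le> real N) \<and> \<not> norm v / Suc n \<le> norm (M s v)" by blast
    from sequence[OF _ this] obtain s v v' where s: "\<And>n. Re (s n) > 0 \<and> norm (s n) \<le> real N"
      and v: "v' \<noteq> 0" "v \<longlonglongrightarrow> v'" "(\<lambda>n. M (s n) (v n)) \<longlonglongrightarrow> 0"
      by auto
    have "bounded (range s)" using s by (auto simp: bounded_iff)
    then obtain s' r where r: "strict_mono (r :: nat \<Rightarrow> nat)" "(s \<circ> r) \<longlonglongrightarrow> s'"
      using bounded_imp_convergent_subsequence by metis
    have "v' = 0"
    proof (rule fin[OF _ r(2)])
      show "(v \<circ> r) \<longlonglongrightarrow> v'" by (rule LIMSEQ_subseq_LIMSEQ[OF v(2) r(1)])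
      show "(\<lambda>n. M ((s \<circ> r) n) ((v \<circ> r) n)) \<longlonglongrightarrow> 0"
        using LIMSEQ_subseq_LIMSEQ[OF v(3) r(1)] by (simp add: o_def)
    qed (use s in auto)
    then show False using v(1) by simp
  qed
  then obtain n where n: "\<And>s v. Re s > 0 \<Longrightarrow> norm s \<le> real N \<Longrightarrow> norm v / Suc n \<le> norm (M s v)"
    by blast
  show ?thesis
  proof
    show "min (1 / Suc N) (1 / Suc n) > 0" by simp
    fix s :: complex and v :: 'a assume s: "Re s > 0"
    have "min (1 / Suc N) (1 / Suc n) * norm v \<le> norm v / Suc N"
      "min (1 / Suc N) (1 / Suc n) * norm v \<le> norm v / Suc n"
      using mult_right_mono[of "min (1 / Suc N) (1 / Suc n)" "1 / Suc N" "norm v"]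
        mult_right_mono[of "min (1 / Suc N) (1 / Suc n)" "1 / Suc n" "norm v"] by auto
    moreover have "norm v / Suc N \<le> norm (M s v) \<or> norm v / Suc n \<le> norm (M s v)"
      using N[OF s, of v] n[OF s, of v] by linarith
    ultimately show "min (1 / Suc N) (1 / Suc n) * norm v \<le> norm (M s v)" by linarith
  qed
qed

subsection \<open>Stability\<close>

lemma hinf_stableI:
  assumes "\<And>s v. Re s > 0 \<Longrightarrow> norm (F s *v v) \<le> B * norm v"
  shows "hinf_stable F"
  unfolding hinf_stable_def bdd_above_def by (auto intro!: exI[of _ B] sigma_max_le assms)

lemma hinf_stable_scalar_tf_bound:
  assumes "hinf_stable (scalar_tf f)"
  obtains B where "\<And>s. Re s > 0 \<Longrightarrow> norm (f s) \<le> B"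
proof -
  obtain B where B: "\<And>s. Re s > 0 \<Longrightarrow> sigma_max (scalar_tf f s) \<le> B"
    using assms unfolding hinf_stable_def bdd_above_def by auto
  have n: "norm (x :: complex ^ 1) = norm (x $ 1)" for x
    by (simp add: norm_vec_def L2_set_def)
  have "norm (f s) \<le> B" if "Re s > 0" for s
    using norm_le_sigma_max[of "scalar_tf f s" "axis 1 1"] B[OF that]
    by (simp add: n scalar_tf_def matrix_vector_mult_def axis_def)
  then show ?thesis by (rule that)
qed

section \<open>DC components and the deviation from their means\<close>

lemma subnetworks_edgeI:
  fixes E :: "('n::finite \<times> 'n) set"
  assumes E: "weighted_graph E w" and ij: "(i, j) \<in> E"
  shows "E\<^sup>* `` {i} \<in> subnetworks E"
proof -
  have "i \<noteq> j" using E ij by (auto simp: weighted_graph_def irrefl_def)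
  then have "2 = card {i, j}" by simp
  also have "\<dots> \<le> card (E\<^sup>* `` {i})" using ij by (intro card_mono) auto
  finally show ?thesis by (simp add: subnetworks_def quotientI)
qed

lemma component_cong_edge:
  fixes E :: "('n::finite \<times> 'n) set"
  assumes E: "weighted_graph E w" and ij: "(i, j) \<in> E"
  shows "E\<^sup>* `` {i} = E\<^sup>* `` {j}"
proof -
  have "(j, i) \<in> E" using E ij by (auto simp: weighted_graph_def sym_def)
  then show ?thesis using ij by (auto intro: converse_rtrancl_into_rtrancl)
qed

text \<open>The bound covers all buses: one without a DC line is its own component and has deviation
  0, while \<open>Delta\<close> is nonnegative as a maximum of norms.\<close>

lemma norm_diff_kinv_mean_le_Delta:
  fixes E :: "('n::finite \<times> 'n) set"
  assumes "subnetworks E \<noteq> {}"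
  shows "norm (1 / k i s - kinv_mean k (E\<^sup>* `` {i}) s) \<le> Delta E k s"
proof -
  have le: "norm (1 / k j s - kinv_mean k C s) \<le> Delta E k s" if "C \<in> subnetworks E" "j \<in> C" for j C
  proof -
    have "norm (1 / k j s - kinv_mean k C s) \<le> (MAX i \<in> C. norm (1 / k i s - kinv_mean k C s))"
      using that by (intro Max_ge) auto
    also have "\<dots> \<le> Delta E k s"
      unfolding Delta_def using that by (intro Max_ge) auto
    finally show ?thesis .
  qed
  show ?thesis
  proof (cases "E\<^sup>* `` {i} \<in> subnetworks E")
    case True
    then show ?thesis by (intro le) auto
  next
    case False
    then have "card (E\<^sup>* `` {i}) < 2" by (simp add: subnetworks_def quotientI not_le)
    moreover have "i \<in> E\<^sup>* `` {i}" by simp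
    moreover from this have "card (E\<^sup>* `` {i}) > 0" by (metis card_gt_0_iff empty_iff finite)
    ultimately have "card (E\<^sup>* `` {i}) = 1" "i \<in> E\<^sup>* `` {i}" by linarith+
    then have "E\<^sup>* `` {i} = {i}" by (metis card_1_singletonE singletonD)
    then have "norm (1 / k i s - kinv_mean k (E\<^sup>* `` {i}) s) = 0" by (simp add: kinv_mean_def)
    moreover obtain C where C: "C \<in> subnetworks E" using assms by blast
    obtain a c where "a \<in> C" by (rule subnetworks_edge[OF C])
    then have "0 \<le> Delta E k s" using le[OF C] norm_ge_zero order_trans by blast
    ultimately show ?thesis by simp
  qed
qed

text \<open>Positivity on the positive axis makes a finite limit nonnegative. Properness bounds
  \<open>g s * k s\<close> near infinity, so its reciprocal stays away from 0.\<close>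

lemma transfer_function_product_inverse_limit:
  assumes g: "transfer_function g" and k: "transfer_function k" and gk: "proper (\<lambda>s. g s * k s)"
    and pos: "\<And>s. Re s \<ge> 0 \<Longrightarrow> s \<noteq> 0 \<Longrightarrow> Re (1 / g s * (1 / k s)) > 0"
  shows "filterlim (\<lambda>s. 1 / g s * (1 / k s)) at_infinity at_infinity \<or>
    (\<exists>a>0. ((\<lambda>s. 1 / g s * (1 / k s)) \<longlongrightarrow> complex_of_real a) at_infinity)"
proof -
  define f where "f s = 1 / g s * (1 / k s)" for s
  have nz: "g s \<noteq> 0" "k s \<noteq> 0" if "Re s \<ge> 0" "s \<noteq> 0" for s
    using pos[OF that] by auto
  obtain qg pg where pg: "\<And>s. 1 / g s = poly (cpoly qg) s / poly (cpoly pg) s"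
    by (rule transfer_function_inverse[OF g]) (rule that)
  obtain qk pk where pk: "\<And>s. 1 / k s = poly (cpoly qk) s / poly (cpoly pk) s"
    by (rule transfer_function_inverse[OF k]) (rule that)
  have hom: "cpoly (p * q) = cpoly p * cpoly q" for p q
    by (intro poly_eqI) (simp add: coeff_map_poly coeff_mult)
  have f: "f s = poly (cpoly (qg * qk)) s / poly (cpoly (pg * pk)) s" for s
    unfolding f_def pg pk by (simp add: hom)
  have "pg * pk \<noteq> 0" using nz[of 1] pg[of 1] pk[of 1] by auto
  from rational_limit_at_infinity[OF this, of "qg * qk"]
  have "filterlim f at_infinity at_infinity \<or> (\<exists>a. (f \<longlongrightarrow> complex_of_real a) at_infinity)"
    unfolding f[symmetric] .
  moreover have "a > 0" if a: "(f \<longlongrightarrow> complex_of_real a) at_infinity" for a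
  proof -
    have lim: "((\<lambda>x. f (complex_of_real x)) \<longlongrightarrow> complex_of_real a) at_top"
      by (rule filterlim_compose[OF a filterlim_of_real_at_infinity])
    then have real: "((\<lambda>x. Re (f (complex_of_real x))) \<longlongrightarrow> a) at_top"
      using tendsto_Re by fastforce
    have "eventually (\<lambda>x. 0 \<le> Re (f (complex_of_real x))) at_top"
      using eventually_gt_at_top[of 0]
      by eventually_elim (unfold f_def, intro less_imp_le pos, auto)
    then have "a \<ge> 0" by (intro tendsto_lowerbound[OF real]) auto
    moreover have "a \<noteq> 0"
    proof
      assume "a = 0"
      obtain C where "eventually (\<lambda>s. norm (g s * k s) \<le> C * norm (1 :: complex)) at_infinity"
        using gk unfolding proper_def by (elim landau_o.bigE)
      from eventually_compose_filterlim[OF this filterlim_of_real_at_infinity]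
      have C: "eventually (\<lambda>x. norm (g (complex_of_real x) * k (complex_of_real x)) \<le> C) at_top"
        by simp
      have "((\<lambda>x. C * norm (f (complex_of_real x))) \<longlongrightarrow> C * norm (complex_of_real a)) at_top"
        by (intro tendsto_mult tendsto_norm tendsto_const lim)
      moreover have "eventually (\<lambda>x. 1 \<le> C * norm (f (complex_of_real x))) at_top"
        using C eventually_gt_at_top[of 0]
      proof eventually_elim
        case (elim x)
        then have "g (complex_of_real x) * k (complex_of_real x) * f (complex_of_real x) = 1"
          using nz[of "complex_of_real x"] by (simp add: f_def)
        then have "1 = norm (g (complex_of_real x) * k (complex_of_real x)) * norm (f (complex_of_real x))"
          by (metis norm_mult norm_one)
        also have "\<dots> \<le> C * norm (f (complex_of_real x))"
          by (intro mult_right_mono elim) simp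
        finally show ?case .
      qed
      ultimately have "1 \<le> C * norm (complex_of_real a)"
        by (intro tendsto_lowerbound) auto
      then show False using \<open>a = 0\<close> by simp
    qed
    ultimately show ?thesis by simp
  qed
  ultimately show ?thesis unfolding f_def by blast
qed

lemma matrix_mult_matrix_inv:
  assumes "invertible A"
  shows "A ** matrix_inv A = mat 1"
  using assms unfolding invertible_def matrix_inv_def by (rule someI2_ex) simp

text \<open>Invertibility belongs to the conclusion because \<open>matrix_inv\<close> of a singular
  matrix is an unspecified value. Properness of each loop product controls the behaviour at
  infinity.\<close>

theorem theorem1:
  fixes g k :: "'n::finite \<Rightarrow> complex \<Rightarrow> complex"
    and Eac Edc :: "('n \<times> 'n) set"
    and b gdc :: "'n \<Rightarrow> 'n \<Rightarrow> real"
    and Lac Ldc :: "real ^ 'n ^ 'n"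
    and \<delta> :: real
  assumes g_tf: "\<And>i. transfer_function (g i)"
    and k_tf: "\<And>i. transfer_function (k i)"
    and gk_proper: "\<And>i. proper (\<lambda>s. g i s * k i s)"
    and ac_graph: "weighted_graph Eac b"
    and dc_graph: "weighted_graph Edc gdc"
    and Lac: "Lac = laplacian Eac b"
    and Ldc: "Ldc = laplacian Edc gdc"
    and delta_pos: "\<delta> > 0"
    and cond1: "\<And>i. hinf_stable (scalar_tf (\<lambda>s. 1 / k i s))"
    and cond2: "\<And>i. \<exists>c>0. \<forall>s\<in>S_delta \<delta>. norm (1 / g i s) \<le> c"
    and cond3: "\<And>i s. Re s \<ge> 0 \<Longrightarrow> s \<noteq> 0 \<Longrightarrow> xi g k i s > 0"
    and cond4: "\<And>s. Re s \<ge> 0 \<Longrightarrow> 1 / real CARD('n) * (\<Sum>i\<in>UNIV. xi g k i s) > 0"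
    and cond5: "\<And>s C. Re s \<ge> 0 \<Longrightarrow> C \<in> subnetworks Edc \<Longrightarrow> Re (kinv_mean k C s) > 0"
      "\<exists>c1>0. \<forall>s\<in>S_delta \<delta>. \<forall>C\<in>subnetworks Edc. Re (kinv_mean k C s) \<ge> c1"
    and cond6: "subnetworks Edc \<noteq> {} \<Longrightarrow>
      \<exists>c2>0. \<forall>s\<in>S_delta \<delta>. Delta Edc k s \<le> c2 * norm s"
    and cond7: "\<And>s. subnetworks Edc \<noteq> {} \<Longrightarrow> Re s \<ge> 0 \<Longrightarrow> s \<noteq> 0 \<Longrightarrow>
      4 * (MIN i\<in>UNIV. xi g k i s) *
        (MIN C\<in>subnetworks Edc.
           Re (kinv_mean k C s) * (lambda_min Edc gdc C / lambda_max Edc gdc))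
      > lambda_max Edc gdc * (Delta Edc k s)\<^sup>2"
    and connected: "graph_connected (Eac \<union> Edc)"
  shows "(\<forall>s. Re s > 0 \<longrightarrow> invertible (Hinv g k Lac Ldc s)) \<and>
    hinf_stable (H g k Lac Ldc) \<and>
    hinf_stable (\<lambda>s. diag_inv k s ** H g k Lac Ldc s)"
proof -
  define f where "f s i = 1 / g i s * (1 / k i s)" for s i
  define \<kappa> where "\<kappa> s i = 1 / k i s" for s i
  define m where "m s i = kinv_mean k (Edc\<^sup>* `` {i}) s" for s i
  have f_xi: "Re (f s i) = xi g k i s" for s i by (simp add: f_def xi_def)

  have irrefl: "irrefl Eac" "irrefl Edc" using ac_graph dc_graph by (auto simp: weighted_graph_def)
  have Hinv: "Hinv g k Lac Ldc s *v v = network_op Eac b Edc gdc (f s) (\<kappa> s) (1 / s) v" for s v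
    unfolding Lac Ldc f_def \<kappa>_def by (rule Hinv_mult_vec[OF irrefl])

  have "\<forall>i. \<exists>B. \<forall>s. Re s > 0 \<longrightarrow> norm (1 / k i s) \<le> B"
    using hinf_stable_scalar_tf_bound[OF cond1] by metis
  then obtain B0 where B0: "\<And>i s. Re s > 0 \<Longrightarrow> norm (1 / k i s) \<le> B0 i" by metis
  define B where "B = Max (range B0)"
  have B: "norm (1 / k i s) \<le> B" if "Re s > 0" for i s
  proof -
    have "B0 i \<le> B" unfolding B_def by (intro Max_ge) auto
    then show ?thesis using B0[OF that, of i] by linarith
  qed
  \<comment> \<open>A zero or a pole of either factor would give \<open>xi\<close> the value 0 under
    \<open>x / 0 = 0\<close>.\<close>
  have nz: "g i s \<noteq> 0" "k i s \<noteq> 0" if "Re s \<ge> 0" "s \<noteq> 0" for i s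
    using cond3[OF that, of i] by (auto simp: xi_def)
  have cont_k: "continuous_on {s. Re s \<ge> 0} (\<lambda>s. 1 / k i s)" for i
    by (rule transfer_function_inverse_continuous[OF k_tf nz(2) zero_less_one B])
  have cont_g: "continuous_on {s. Re s \<ge> 0} (\<lambda>s. 1 / g i s)" for i
  proof -
    obtain c where "\<forall>s\<in>S_delta \<delta>. norm (1 / g i s) \<le> c" using cond2 by blast
    then show ?thesis
      by (intro transfer_function_inverse_continuous[OF g_tf nz(1) delta_pos, of i c])
        (auto simp: S_delta_def)
  qed

  have subnet: "Edc\<^sup>* `` {i} \<in> subnetworks Edc" if "(i, j) \<in> Edc" for i j
    by (rule subnetworks_edgeI[OF dc_graph that])
  have subnet_ne: "subnetworks Edc \<noteq> {}" if "Edc \<noteq> {}" using that subnet by auto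
  have m_edge: "m s i = m s j" if "(i, j) \<in> Edc" for s i j
    unfolding m_def component_cong_edge[OF dc_graph that] ..
  have m_pos: "Re (m s i) > 0" if "Re s \<ge> 0" "(i, j) \<in> Edc" for s i j
    unfolding m_def using that by (intro cond5(1) subnet)
  have dev: "norm (\<kappa> s i - m s i) \<le> Delta Edc k s" if "Edc \<noteq> {}" for s i
    unfolding \<kappa>_def m_def by (rule norm_diff_kinv_mean_le_Delta[OF subnet_ne[OF that]])
  \<comment> \<open>Condition 6 at \<open>s = 0\<close> forces \<open>Delta\<close> to vanish there;
    without DC lines every component is a singleton.\<close>
  have m0: "\<kappa> 0 i = m 0 i" for i
  proof (cases "Edc = {}")
    case True
    then show ?thesis by (simp add: \<kappa>_def m_def kinv_mean_def)
  next
    case False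
    then obtain c2 where "\<forall>s\<in>S_delta \<delta>. Delta Edc k s \<le> c2 * norm s"
      using cond6[OF subnet_ne] by blast
    moreover have "0 \<in> S_delta \<delta>" using delta_pos by (simp add: S_delta_def)
    ultimately have "Delta Edc k 0 \<le> 0" by fastforce
    from order_trans[OF dev[OF False, of 0 i] this] show ?thesis by simp
  qed

  \<comment> \<open>On a DC line condition 5 makes the mean at 0 positive, and by \<open>m0\<close>
    this is the value of \<open>1 / k i\<close> itself.\<close>
  have lim_k: "\<exists>a. ((\<lambda>s. \<kappa> s i) \<longlongrightarrow> complex_of_real a) at_infinity \<and> (\<forall>j. (i, j) \<in> Edc \<longrightarrow> a \<ge> 0)" for i
  proof -
    obtain a where "((\<lambda>s. 1 / k i s) \<longlongrightarrow> complex_of_real a) at_infinity" "Re (1 / k i 0) > 0 \<longrightarrow> a \<ge> 0"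
      by (rule transfer_function_inverse_limit_nonneg[OF k_tf[of i], where B = B])
        (rule nz(2) B that; assumption)+
    then show ?thesis using m_pos[of 0 i] m0[of i] unfolding \<kappa>_def by (metis order_refl zero_complex.sel(1))
  qed
  then obtain a where a: "\<And>i. ((\<lambda>s. \<kappa> s i) \<longlongrightarrow> complex_of_real (a i)) at_infinity"
    "\<And>i j. (i, j) \<in> Edc \<Longrightarrow> a i \<ge> 0" by metis
  have lim_f: "filterlim (\<lambda>s. f s i) at_infinity at_infinity \<or>
      (\<exists>a>0. ((\<lambda>s. f s i) \<longlongrightarrow> complex_of_real a) at_infinity)" for i
    unfolding f_def
    by (rule transfer_function_product_inverse_limit[OF g_tf k_tf gk_proper])
      (use cond3 in \<open>auto simp: xi_def\<close>)

  have seq_k: "(\<lambda>n. \<kappa> (s n) i) \<longlonglongrightarrow> \<kappa> s' i" and seq_g: "(\<lambda>n. 1 / g i (s n)) \<longlonglongrightarrow> 1 / g i s'"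
    if "\<And>n. Re (s n) > 0" "s \<longlonglongrightarrow> s'" "Re s' \<ge> 0" for s :: "nat \<Rightarrow> complex" and s' i
    unfolding \<kappa>_def using that
    by (auto intro!: continuous_on_tendsto_compose[OF cont_k] continuous_on_tendsto_compose[OF cont_g]
        always_eventually less_imp_le)

  obtain c where c: "c > 0" "\<And>s v. Re s > 0 \<Longrightarrow> c * norm v \<le> norm (Hinv g k Lac Ldc s *v v)"
  proof (rule uniform_lower_bound[of "\<lambda>s v. Hinv g k Lac Ldc s *v v"])
    show "linear ((*v) (Hinv g k Lac Ldc s))" for s by (rule linear_matrix_vector_mult_complex)
  next
    fix s :: "nat \<Rightarrow> complex" and v v'
    assume "\<And>n. Re (s n) > 0" and s: "filterlim s at_infinity sequentially"
      and v: "v \<longlonglongrightarrow> v'" "(\<lambda>n. Hinv g k Lac Ldc (s n) *v v n) \<longlonglongrightarrow> 0"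
    show "v' = 0"
    proof (rule network_op_kernel_at_infinity[OF dc_graph _ _ a(2) _ v(1) v(2)[unfolded Hinv]])
      show "filterlim (\<lambda>n. f (s n) i) at_infinity sequentially \<or>
          (\<exists>a>0. (\<lambda>n. f (s n) i) \<longlonglongrightarrow> complex_of_real a)" for i
        using lim_f[of i] filterlim_compose[OF _ s] by blast
      show "(\<lambda>n. \<kappa> (s n) i) \<longlonglongrightarrow> complex_of_real (a i)" for i
        by (rule filterlim_compose[OF a(1) s])
      show "(\<lambda>n. 1 / s n) \<longlonglongrightarrow> 0"
        by (rule tendsto_divide_0[OF tendsto_const s])
    qed
  next
    fix s :: "nat \<Rightarrow> complex" and s' v v'
    assume s: "\<And>n. Re (s n) > 0" "s \<longlonglongrightarrow> s'"
      and v: "v \<longlonglongrightarrow> v'" "(\<lambda>n. Hinv g k Lac Ldc (s n) *v v n) \<longlonglongrightarrow> 0"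
    have s': "Re s' \<ge> 0"
      by (rule LIMSEQ_le_const[OF tendsto_Re[OF s(2)]]) (use s(1) in \<open>auto intro: less_imp_le\<close>)
    have f: "(\<lambda>n. f (s n) i) \<longlonglongrightarrow> f s' i" for i
      using tendsto_mult[OF seq_g[OF s s'] seq_k[OF s s']] by (simp add: f_def \<kappa>_def)
    show "v' = 0"
    proof (cases "s' = 0")
      case True
      show ?thesis
      proof (rule network_op_kernel_at_zero[OF ac_graph dc_graph connected f _ _ _ _ _ _ _ s(1) v(1) v(2)[unfolded Hinv],
            where m = "\<lambda>n. m (s n)" and m' = "m 0"])
        show "Re (f (s n) i) \<ge> 0" for n i
          unfolding f_xi using s(1)[of n] by (intro less_imp_le cond3) auto
        have "0 < 1 / real CARD('n) * (\<Sum>i\<in>UNIV. xi g k i s')" using cond4[of s'] True by simp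
        then show "0 < (\<Sum>i\<in>UNIV. Re (f s' i))" by (simp add: f_xi zero_less_divide_iff)
        show "(\<lambda>n. m (s n) i) \<longlonglongrightarrow> m 0 i" for i
        proof -
          have "card (Edc\<^sup>* `` {i}) \<noteq> 0" by (auto simp: card_eq_0_iff)
          then show ?thesis
            unfolding m_def kinv_mean_def
            by (intro tendsto_divide tendsto_sum tendsto_const seq_k[OF s s', unfolded \<kappa>_def True]) simp
        qed
        show "(\<lambda>n. \<kappa> (s n) i) \<longlonglongrightarrow> m 0 i" for i
          using seq_k[OF s s', of i] unfolding True m0 .
      qed (use m_edge m_pos s(2) True in auto)
    next
      case False
      show ?thesis
      proof (rule ccontr)
        assume "v' \<noteq> 0"
        let ?N = "network_op Eac b Edc gdc (f s') (\<kappa> s') (1 / s') v'"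
        have "(\<lambda>n. Hinv g k Lac Ldc (s n) *v v n) \<longlonglongrightarrow> ?N"
          unfolding Hinv by (intro tendsto_network_op f seq_k s s' v tendsto_divide tendsto_const False)
        then have "?N = 0" using v(2) LIMSEQ_unique by blast
        define \<xi> where "\<xi> = (MIN i\<in>UNIV. xi g k i s')"
        define \<mu> where "\<mu> = Min ((\<lambda>C. Re (kinv_mean k C s')) ` subnetworks Edc)"
        have "inner v' ?N > 0"
        \<comment> \<open>Without DC lines \<mu> is a minimum over the empty set, so 0 takes its
          place.\<close>
        proof (rule inner_network_op_pos[OF ac_graph dc_graph, where \<xi> = \<xi> and m = "m s'"
              and \<mu> = "if Edc = {} then 0 else \<mu>" and D = "Delta Edc k s'"])
          show "Re (1 / s') \<ge> 0" using s' by (simp add: Re_divide divide_nonneg_nonneg)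
          show "\<xi> > 0" unfolding \<xi>_def using s' False by (subst Min_gr_iff) (auto intro: cond3)
          show "\<xi> \<le> Re (f s' i)" for i unfolding \<xi>_def f_xi by (intro Min_le) auto
          show "(if Edc = {} then 0 else \<mu>) \<le> Re (m s' i)" if "(i, j) \<in> Edc" for i j
            using that subnet[OF that] by (auto simp: \<mu>_def m_def intro!: Min_le)
          have \<mu>: "\<exists>C\<in>subnetworks Edc. \<mu> = Re (kinv_mean k C s')" if "Edc \<noteq> {}"
          proof -
            have "\<mu> \<in> (\<lambda>C. Re (kinv_mean k C s')) ` subnetworks Edc"
              unfolding \<mu>_def using subnet_ne[OF that] by (intro Min_in) auto
            then show ?thesis by blast
          qed
          then show "(if Edc = {} then 0 else \<mu>) \<ge> 0"
            using cond5(1)[OF s'] by (auto intro: less_imp_le)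
          show "lambda_max Edc gdc > 0" if "Edc \<noteq> {}"
            using lambda_min_le_lambda_max(2)[OF dc_graph] subnet_ne[OF that] by blast
          show "lambda_max Edc gdc * (Delta Edc k s')\<^sup>2 < 4 * \<xi> * (if Edc = {} then 0 else \<mu>)"
            if ne: "Edc \<noteq> {}"
          proof -
            \<comment> \<open>At the subnetwork attaining \<mu>, the eigenvalue ratio at most 1
              bounds the minimum in condition 7 by \<mu>, which yields the discriminant
              inequality.\<close>
            obtain C where C: "C \<in> subnetworks Edc" "\<mu> = Re (kinv_mean k C s')" using \<mu>[OF ne] by blast
            let ?r = "\<lambda>C. lambda_min Edc gdc C / lambda_max Edc gdc"
            have "(MIN C\<in>subnetworks Edc. Re (kinv_mean k C s') * ?r C) \<le> \<mu> * ?r C"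
              unfolding C(2) using C(1) by (intro Min_le) auto
            also have "\<dots> \<le> \<mu> * 1"
              using lambda_min_le_lambda_max[OF dc_graph C(1)] cond5(1)[OF s' C(1)]
              by (intro mult_left_mono) (auto simp: C(2))
            finally have "4 * \<xi> * (MIN C\<in>subnetworks Edc. Re (kinv_mean k C s') * ?r C) \<le> 4 * \<xi> * \<mu>"
              using \<open>\<xi> > 0\<close> by simp
            then show ?thesis
              using cond7[OF subnet_ne[OF ne] s' False] ne by (simp add: \<xi>_def)
          qed
        qed (use m_edge dev \<open>v' \<noteq> 0\<close> in auto)
        then show False using \<open>?N = 0\<close> by simp
      qed
    qed
  qed (rule that)

  have inv: "invertible (Hinv g k Lac Ldc s)" if "Re s > 0" for s
  proof -
    have "inj ((*v) (Hinv g k Lac Ldc s))"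
    proof (rule linear_injective_0[THEN iffD2, rule_format, OF linear_matrix_vector_mult_complex])
      show "v = 0" if "Hinv g k Lac Ldc s *v v = 0" for v
        using c(1) c(2)[OF \<open>Re s > 0\<close>, of v] that by (simp add: mult_le_0_iff)
    qed
    then show ?thesis
      by (simp add: invertible_left_inverse matrix_left_invertible_injective)
  qed
  have H: "norm (H g k Lac Ldc s *v v) \<le> 1 / c * norm v" if "Re s > 0" for s v
  proof -
    have "Hinv g k Lac Ldc s *v (H g k Lac Ldc s *v v) = v"
      using matrix_mult_matrix_inv[OF inv[OF that]] by (simp add: H_def matrix_vector_mul_assoc)
    then show ?thesis
      using c(1) c(2)[OF that, of "H g k Lac Ldc s *v v"] by (simp add: field_simps)
  qed
  \<comment> \<open>The factor \<open>B\<close> is the common bound on all \<open>1 / k i\<close>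
    supplied by condition 1.\<close>
  have KH: "norm ((diag_inv k s ** H g k Lac Ldc s) *v v) \<le> B * (1 / c) * norm v" if "Re s > 0" for s v
  proof -
    have "B \<ge> 0" using B[OF that] norm_ge_zero order_trans by blast
    have "norm (diag_inv k s *v (H g k Lac Ldc s *v v)) \<le> B * norm (H g k Lac Ldc s *v v)"
      unfolding diag_inv_def by (intro norm_diag_le B that)
    also have "\<dots> \<le> B * (1 / c * norm v)"
      by (intro mult_left_mono H that \<open>B \<ge> 0\<close>)
    finally show ?thesis by (simp add: matrix_vector_mul_assoc)
  qed
  show ?thesis
    by (intro conjI allI impI inv hinf_stableI[of _ "1 / c"] hinf_stableI[of _ "B * (1 / c)"] H KH)
qed

end
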